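(* Let $f\colon\mathcal D\to\mathcal F$ be a functor, where $\mathcal D$ and $\mathcal F$ are abelian categories with enough projective and injective objects, and let $t$ be a nonnegative integer. Consider the following four statements. (a) For every $D$ in $\mathcal D$: $\operatorname{pd}_{\mathcal D}D\le\sup\{\operatorname{pd}_{\mathcal F}f(D),t\}$ and $\operatorname{id}_{\mathcal D}D\le\sup\{\operatorname{id}_{\mathcal F}f(D),t\}$. (b) For every $D$ in $\mathcal D$: $\operatorname{pd}_{\mathcal F}f(D)\le\sup\{\operatorname{pd}_{\mathcal D}D,t\}$ and $\operatorname{id}_{\mathcal F}f(D)\le\sup\{\operatorname{id}_{\mathcal D}D,t\}$. (c) $\operatorname{spli}\mathcal D\le\sup\{\operatorname{spli}\mathcal F,t\}$ and $\operatorname{silp}\mathcal D\le\sup\{\operatorname{silp}\mathcal F,t\}$. (d) $\operatorname{spli}\mathcal F\le\sup\{\operatorname{spli}\mathcal D,t\}$ and $\operatorname{silp}\mathcal F\le\sup\{\operatorname{silp}\mathcal D,t\}$. Then: (i) If $f$ is a $t$-homological isomorphism, then (a) holds. (ii) If $f$ is an essentially surjective $t$-homological isomorphism, then (a) and (b) hold. (iii) If (a) and (b) hold, then (c) holds. (iv) If (a) and (b) hold and $f$ is essentially surjective, then (c) and (d) hold. In particular: (v) If $f$ is an essentially surjective eventually homological isomorphism, then $\mathcal D$ is Gorenstein if and only if $\mathcal F$ is Gorenstein. (vi) If $f$ is an eventually homological isomorphism and (b) holds, then $\mathcal F$ being Gorenstein implies that $\mathcal D$ is Gorenstein.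
   Context: For an abelian category $\mathcal A$ with enough projective and injective objects, $\operatorname{spli}\mathcal A=\sup\{\operatorname{pd}_{\mathcal A}I\mid I\ \text{injective in }\mathcal A\}$ and $\operatorname{silp}\mathcal A=\sup\{\operatorname{id}_{\mathcal A}P\mid P\ \text{projective in }\mathcal A\}$. Such an $\mathcal A$ is called Gorenstein if $\operatorname{spli}\mathcal A<\infty$ and $\operatorname{silp}\mathcal A<\infty$. A functor $f\colon\mathcal D\to\mathcal F$ between abelian categories is a $t$-homological isomorphism ($t$ an integer) if there is an isomorphism $\operatorname{Ext}^j_{\mathcal D}(X,Y)\cong\operatorname{Ext}^j_{\mathcal F}(f(X),f(Y))$ for all objects $X,Y$ of $\mathcal D$ and all $j>t$; it is an eventually homological isomorphism if it is a $t$-homological isomorphism for some $t$. *)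

theory Defs
  imports "HOL-Algebra.Coset" "HOL-Library.Extended_Nat"
begin

section \<open>Abelian categories\<close>

text \<open>
  A category with an addition on each set of parallel morphisms.  \<open>Comp C g f\<close> is the
  composite \<open>g\<close> after \<open>f\<close>.
\<close>

record ('o, 'm) precat =
  Obj :: "'o set"
  Arr :: "'m set"
  Dom :: "'m \<Rightarrow> 'o"
  Cod :: "'m \<Rightarrow> 'o"
  Ident :: "'o \<Rightarrow> 'm"
  Comp :: "'m \<Rightarrow> 'm \<Rightarrow> 'm"
  Add :: "'m \<Rightarrow> 'm \<Rightarrow> 'm"
  ZeroMor :: "'o \<Rightarrow> 'o \<Rightarrow> 'm"

definition Hom :: "('o, 'm) precat \<Rightarrow> 'o \<Rightarrow> 'o \<Rightarrow> 'm set" where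
  "Hom C X Y = {f \<in> Arr C. Dom C f = X \<and> Cod C f = Y}"

text \<open>
  The additive group of morphisms, written as a multiplicative record because quotients and
  isomorphisms of groups in HOL-Algebra are formulated for those.
\<close>

definition hom_group :: "('o, 'm) precat \<Rightarrow> 'o \<Rightarrow> 'o \<Rightarrow> 'm monoid" where
  "hom_group C X Y = \<lparr>carrier = Hom C X Y, monoid.mult = Add C, one = ZeroMor C X Y\<rparr>"

locale category =
  fixes C :: "('o, 'm) precat"
  assumes dom_obj: "f \<in> Arr C \<Longrightarrow> Dom C f \<in> Obj C"
    and cod_obj: "f \<in> Arr C \<Longrightarrow> Cod C f \<in> Obj C"
    and ident_hom: "X \<in> Obj C \<Longrightarrow> Ident C X \<in> Hom C X X"
    and comp_hom: "f \<in> Hom C X Y \<Longrightarrow> g \<in> Hom C Y Z \<Longrightarrow> Comp C g f \<in> Hom C X Z"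
    and comp_assoc: "f \<in> Hom C W X \<Longrightarrow> g \<in> Hom C X Y \<Longrightarrow> h \<in> Hom C Y Z \<Longrightarrow>
      Comp C h (Comp C g f) = Comp C (Comp C h g) f"
    and comp_ident_right: "f \<in> Hom C X Y \<Longrightarrow> Comp C f (Ident C X) = f"
    and comp_ident_left: "f \<in> Hom C X Y \<Longrightarrow> Comp C (Ident C Y) f = f"

locale preadditive_category = category C for C :: "('o, 'm) precat" +
  assumes hom_comm_group: "X \<in> Obj C \<Longrightarrow> Y \<in> Obj C \<Longrightarrow> comm_group (hom_group C X Y)"
    and comp_add_right: "f \<in> Hom C X Y \<Longrightarrow> f' \<in> Hom C X Y \<Longrightarrow> g \<in> Hom C Y Z \<Longrightarrow>
      Comp C g (Add C f f') = Add C (Comp C g f) (Comp C g f')"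
    and comp_add_left: "f \<in> Hom C X Y \<Longrightarrow> g \<in> Hom C Y Z \<Longrightarrow> g' \<in> Hom C Y Z \<Longrightarrow>
      Comp C (Add C g g') f = Add C (Comp C g f) (Comp C g' f)"

definition zero_object :: "('o, 'm) precat \<Rightarrow> 'o \<Rightarrow> bool" where
  "zero_object C Z \<longleftrightarrow> Z \<in> Obj C \<and>
    (\<forall>X \<in> Obj C. (\<exists>!f. f \<in> Hom C X Z) \<and> (\<exists>!f. f \<in> Hom C Z X))"

definition isomorphic_objects :: "('o, 'm) precat \<Rightarrow> 'o \<Rightarrow> 'o \<Rightarrow> bool" where
  "isomorphic_objects C X Y \<longleftrightarrow> (\<exists>f \<in> Hom C X Y. \<exists>g \<in> Hom C Y X.
    Comp C g f = Ident C X \<and> Comp C f g = Ident C Y)"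

definition monic :: "('o, 'm) precat \<Rightarrow> 'm \<Rightarrow> bool" where
  "monic C f \<longleftrightarrow> f \<in> Arr C \<and>
    (\<forall>W. \<forall>g \<in> Hom C W (Dom C f). \<forall>h \<in> Hom C W (Dom C f). Comp C f g = Comp C f h \<longrightarrow> g = h)"

definition epic :: "('o, 'm) precat \<Rightarrow> 'm \<Rightarrow> bool" where
  "epic C f \<longleftrightarrow> f \<in> Arr C \<and>
    (\<forall>W. \<forall>g \<in> Hom C (Cod C f) W. \<forall>h \<in> Hom C (Cod C f) W. Comp C g f = Comp C h f \<longrightarrow> g = h)"

definition is_kernel :: "('o, 'm) precat \<Rightarrow> 'm \<Rightarrow> 'm \<Rightarrow> bool" where
  "is_kernel C f k \<longleftrightarrow> f \<in> Arr C \<and> k \<in> Arr C \<and> Cod C k = Dom C f \<and>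
    Comp C f k = ZeroMor C (Dom C k) (Cod C f) \<and>
    (\<forall>W. \<forall>g \<in> Hom C W (Dom C f). Comp C f g = ZeroMor C W (Cod C f) \<longrightarrow>
      (\<exists>!h. h \<in> Hom C W (Dom C k) \<and> Comp C k h = g))"

definition is_cokernel :: "('o, 'm) precat \<Rightarrow> 'm \<Rightarrow> 'm \<Rightarrow> bool" where
  "is_cokernel C f c \<longleftrightarrow> f \<in> Arr C \<and> c \<in> Arr C \<and> Dom C c = Cod C f \<and>
    Comp C c f = ZeroMor C (Dom C f) (Cod C c) \<and>
    (\<forall>W. \<forall>g \<in> Hom C (Cod C f) W. Comp C g f = ZeroMor C (Dom C f) W \<longrightarrow>
      (\<exists>!h. h \<in> Hom C (Cod C c) W \<and> Comp C h c = g))"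

definition is_biproduct ::
  "('o, 'm) precat \<Rightarrow> 'o \<Rightarrow> 'o \<Rightarrow> 'o \<Rightarrow> 'm \<Rightarrow> 'm \<Rightarrow> 'm \<Rightarrow> 'm \<Rightarrow> bool" where
  "is_biproduct C X Y B i j p q \<longleftrightarrow> B \<in> Obj C \<and>
    i \<in> Hom C X B \<and> j \<in> Hom C Y B \<and> p \<in> Hom C B X \<and> q \<in> Hom C B Y \<and>
    Comp C p i = Ident C X \<and> Comp C q j = Ident C Y \<and>
    Comp C p j = ZeroMor C Y X \<and> Comp C q i = ZeroMor C X Y \<and>
    Add C (Comp C i p) (Comp C j q) = Ident C B"

locale abelian_category = preadditive_category C for C :: "('o, 'm) precat" +
  assumes ex_zero_object: "\<exists>Z. zero_object C Z"
    and ex_biproduct: "X \<in> Obj C \<Longrightarrow> Y \<in> Obj C \<Longrightarrow> \<exists>B i j p q. is_biproduct C X Y B i j p q"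
    and ex_kernel: "f \<in> Arr C \<Longrightarrow> \<exists>k. is_kernel C f k"
    and ex_cokernel: "f \<in> Arr C \<Longrightarrow> \<exists>c. is_cokernel C f c"
    and monic_is_kernel: "monic C k \<Longrightarrow> \<exists>f. is_kernel C f k"
    and epic_is_cokernel: "epic C c \<Longrightarrow> \<exists>f. is_cokernel C f c"

text \<open>The image of a morphism is the kernel of its cokernel.\<close>

definition is_image :: "('o, 'm) precat \<Rightarrow> 'm \<Rightarrow> 'm \<Rightarrow> bool" where
  "is_image C f m \<longleftrightarrow> (\<exists>c. is_cokernel C f c \<and> is_kernel C c m)"

text \<open>
  Exactness of \<open>A \<rightarrow> B \<rightarrow> C\<close> (maps \<open>f\<close> and \<open>g\<close>) at the middle object: the image of \<open>f\<close> and the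
  kernel of \<open>g\<close> are the same subobject, i.e. some monomorphism represents both.
\<close>

definition exact_at :: "('o, 'm) precat \<Rightarrow> 'm \<Rightarrow> 'm \<Rightarrow> bool" where
  "exact_at C f g \<longleftrightarrow> (\<exists>m. is_image C f m \<and> is_kernel C g m)"

definition projective_object :: "('o, 'm) precat \<Rightarrow> 'o \<Rightarrow> bool" where
  "projective_object C P \<longleftrightarrow> P \<in> Obj C \<and>
    (\<forall>e. epic C e \<longrightarrow> (\<forall>f \<in> Hom C P (Cod C e). \<exists>g \<in> Hom C P (Dom C e). Comp C e g = f))"

definition injective_object :: "('o, 'm) precat \<Rightarrow> 'o \<Rightarrow> bool" where
  "injective_object C I \<longleftrightarrow> I \<in> Obj C \<and>
    (\<forall>m. monic C m \<longrightarrow> (\<forall>f \<in> Hom C (Dom C m) I. \<exists>g \<in> Hom C (Cod C m) I. Comp C g m = f))"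

definition enough_projectives :: "('o, 'm) precat \<Rightarrow> bool" where
  "enough_projectives C \<longleftrightarrow>
    (\<forall>X \<in> Obj C. \<exists>P e. projective_object C P \<and> e \<in> Hom C P X \<and> epic C e)"

definition enough_injectives :: "('o, 'm) precat \<Rightarrow> bool" where
  "enough_injectives C \<longleftrightarrow>
    (\<forall>X \<in> Obj C. \<exists>I m. injective_object C I \<and> m \<in> Hom C X I \<and> monic C m)"


section \<open>Resolutions, homological dimensions and Ext\<close>

text \<open>\<open>\<dots> \<rightarrow> P 2 \<rightarrow> P 1 \<rightarrow> P 0 \<rightarrow> X \<rightarrow> 0\<close> with differentials \<open>d n\<close> and augmentation \<open>e\<close>.\<close>

definition projective_resolution ::
  "('o, 'm) precat \<Rightarrow> 'o \<Rightarrow> (nat \<Rightarrow> 'o) \<Rightarrow> (nat \<Rightarrow> 'm) \<Rightarrow> 'm \<Rightarrow> bool" where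
  "projective_resolution C X P d e \<longleftrightarrow>
    (\<forall>n. projective_object C (P n)) \<and> (\<forall>n. d n \<in> Hom C (P (Suc n)) (P n)) \<and>
    e \<in> Hom C (P 0) X \<and> epic C e \<and> exact_at C (d 0) e \<and>
    (\<forall>n. exact_at C (d (Suc n)) (d n))"

text \<open>\<open>0 \<rightarrow> X \<rightarrow> I 0 \<rightarrow> I 1 \<rightarrow> I 2 \<rightarrow> \<dots>\<close> with coaugmentation \<open>e\<close> and differentials \<open>d n\<close>.\<close>

definition injective_resolution ::
  "('o, 'm) precat \<Rightarrow> 'o \<Rightarrow> (nat \<Rightarrow> 'o) \<Rightarrow> (nat \<Rightarrow> 'm) \<Rightarrow> 'm \<Rightarrow> bool" where
  "injective_resolution C X I d e \<longleftrightarrow>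
    (\<forall>n. injective_object C (I n)) \<and> (\<forall>n. d n \<in> Hom C (I n) (I (Suc n))) \<and>
    e \<in> Hom C X (I 0) \<and> monic C e \<and> exact_at C e (d 0) \<and>
    (\<forall>n. exact_at C (d n) (d (Suc n)))"

text \<open>
  The dimensions are the least lengths of resolutions; they are \<open>\<infinity>\<close> if there is no finite
  resolution, and \<open>0\<close> for zero objects.
\<close>

definition proj_dim :: "('o, 'm) precat \<Rightarrow> 'o \<Rightarrow> enat" where
  "proj_dim C X = Inf {enat n |n. \<exists>P d e. projective_resolution C X P d e \<and>
    (\<forall>i>n. zero_object C (P i))}"

definition inj_dim :: "('o, 'm) precat \<Rightarrow> 'o \<Rightarrow> enat" where
  "inj_dim C X = Inf {enat n |n. \<exists>I d e. injective_resolution C X I d e \<and>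
    (\<forall>i>n. zero_object C (I i))}"

definition spli :: "('o, 'm) precat \<Rightarrow> enat" where
  "spli C = (SUP I \<in> {I. injective_object C I}. proj_dim C I)"

definition silp :: "('o, 'm) precat \<Rightarrow> enat" where
  "silp C = (SUP P \<in> {P. projective_object C P}. inj_dim C P)"

definition gorenstein :: "('o, 'm) precat \<Rightarrow> bool" where
  "gorenstein C \<longleftrightarrow> spli C < \<infinity> \<and> silp C < \<infinity>"

text \<open>
  For a complex \<open>P\<close> with differentials \<open>d n : P (n + 1) \<rightarrow> P n\<close>, the cocycles, the coboundaries and
  the cohomology group in degree \<open>n\<close> of the complex \<open>Hom(P, Y)\<close> of abelian groups.
\<close>

definition hom_cocycles ::
  "('o, 'm) precat \<Rightarrow> (nat \<Rightarrow> 'o) \<Rightarrow> (nat \<Rightarrow> 'm) \<Rightarrow> 'o \<Rightarrow> nat \<Rightarrow> 'm set" where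
  "hom_cocycles C P d Y n =
    kernel (hom_group C (P n) Y) (hom_group C (P (Suc n)) Y) (\<lambda>f. Comp C f (d n))"

definition hom_coboundaries ::
  "('o, 'm) precat \<Rightarrow> (nat \<Rightarrow> 'o) \<Rightarrow> (nat \<Rightarrow> 'm) \<Rightarrow> 'o \<Rightarrow> nat \<Rightarrow> 'm set" where
  "hom_coboundaries C P d Y n = (case n of
      0 \<Rightarrow> {ZeroMor C (P 0) Y}
    | Suc k \<Rightarrow> (\<lambda>f. Comp C f (d k)) ` Hom C (P k) Y)"

definition hom_cohomology ::
  "('o, 'm) precat \<Rightarrow> (nat \<Rightarrow> 'o) \<Rightarrow> (nat \<Rightarrow> 'm) \<Rightarrow> 'o \<Rightarrow> nat \<Rightarrow> 'm set monoid" where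
  "hom_cohomology C P d Y n =
    (hom_group C (P n) Y)\<lparr>carrier := hom_cocycles C P d Y n\<rparr> Mod hom_coboundaries C P d Y n"

text \<open>
  Ext as the right derived functor of \<open>Hom(-, Y)\<close>, computed from a chosen projective resolution
  of \<open>X\<close>.
\<close>

definition Ext :: "('o, 'm) precat \<Rightarrow> nat \<Rightarrow> 'o \<Rightarrow> 'o \<Rightarrow> 'm set monoid" where
  "Ext C n X Y = (case SOME (P, d, e). projective_resolution C X P d e of
    (P, d, e) \<Rightarrow> hom_cohomology C P d Y n)"


section \<open>Functors and homological isomorphisms\<close>

locale cat_functor = source: category D + target: category F
  for D :: "('o, 'm) precat" and F :: "('p, 'n) precat" +
  fixes fo :: "'o \<Rightarrow> 'p" and fm :: "'m \<Rightarrow> 'n"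
  assumes map_obj: "X \<in> Obj D \<Longrightarrow> fo X \<in> Obj F"
    and map_hom: "h \<in> Hom D X Y \<Longrightarrow> fm h \<in> Hom F (fo X) (fo Y)"
    and map_ident: "X \<in> Obj D \<Longrightarrow> fm (Ident D X) = Ident F (fo X)"
    and map_comp: "h \<in> Hom D X Y \<Longrightarrow> k \<in> Hom D Y Z \<Longrightarrow> fm (Comp D k h) = Comp F (fm k) (fm h)"

definition essentially_surjective ::
  "('o, 'm) precat \<Rightarrow> ('p, 'n) precat \<Rightarrow> ('o \<Rightarrow> 'p) \<Rightarrow> bool" where
  "essentially_surjective D F fo \<longleftrightarrow>
    (\<forall>Y \<in> Obj F. \<exists>X \<in> Obj D. isomorphic_objects F (fo X) Y)"

text \<open>
  The bound \<open>t\<close> may be negative; since Ext vanishes in negative degrees, only the degrees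
  \<open>j \<ge> 0\<close> impose a condition.  The isomorphisms of abelian groups are not required to be natural
  or to be induced by the functor.
\<close>

definition homological_isomorphism ::
  "('o, 'm) precat \<Rightarrow> ('p, 'n) precat \<Rightarrow> ('o \<Rightarrow> 'p) \<Rightarrow> int \<Rightarrow> bool" where
  "homological_isomorphism D F fo t \<longleftrightarrow>
    (\<forall>X \<in> Obj D. \<forall>Y \<in> Obj D. \<forall>j. int j > t \<longrightarrow> Ext D j X Y \<cong> Ext F j (fo X) (fo Y))"

definition eventually_homological_isomorphism ::
  "('o, 'm) precat \<Rightarrow> ('p, 'n) precat \<Rightarrow> ('o \<Rightarrow> 'p) \<Rightarrow> bool" where
  "eventually_homological_isomorphism D F fo \<longleftrightarrow> (\<exists>t. homological_isomorphism D F fo t)"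

definition condition_a ::
  "('o, 'm) precat \<Rightarrow> ('p, 'n) precat \<Rightarrow> ('o \<Rightarrow> 'p) \<Rightarrow> nat \<Rightarrow> bool" where
  "condition_a D F fo t \<longleftrightarrow> (\<forall>X \<in> Obj D.
    proj_dim D X \<le> sup (proj_dim F (fo X)) (enat t) \<and>
    inj_dim D X \<le> sup (inj_dim F (fo X)) (enat t))"

definition condition_b ::
  "('o, 'm) precat \<Rightarrow> ('p, 'n) precat \<Rightarrow> ('o \<Rightarrow> 'p) \<Rightarrow> nat \<Rightarrow> bool" where
  "condition_b D F fo t \<longleftrightarrow> (\<forall>X \<in> Obj D.
    proj_dim F (fo X) \<le> sup (proj_dim D X) (enat t) \<and>
    inj_dim F (fo X) \<le> sup (inj_dim D X) (enat t))"

definition condition_c :: "('o, 'm) precat \<Rightarrow> ('p, 'n) precat \<Rightarrow> nat \<Rightarrow> bool" where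
  "condition_c D F t \<longleftrightarrow>
    spli D \<le> sup (spli F) (enat t) \<and> silp D \<le> sup (silp F) (enat t)"

definition condition_d :: "('o, 'm) precat \<Rightarrow> ('p, 'n) precat \<Rightarrow> nat \<Rightarrow> bool" where
  "condition_d D F t \<longleftrightarrow>
    spli F \<le> sup (spli D) (enat t) \<and> silp F \<le> sup (silp D) (enat t)"

end

theory Submission
  imports Defs
begin

text \<open>
  An object has projective (injective) dimension at most \<open>m\<close> iff \<open>Ext n\<close> vanishes on it for all
  \<open>n > m\<close> in the first (second) argument, so isomorphisms of Ext groups in degrees above \<open>t\<close>
  transfer dimensions up to \<open>t\<close>.  Moreover \<open>pd X \<le> spli\<close> whenever \<open>id X < \<infinity>\<close>, by descending along a
  finite injective resolution; applied to \<open>f I\<close> for injective \<open>I\<close>, whose injective dimension is at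
  most \<open>t\<close>, this compares the two values of spli.  The statements on injective dimension and silp
  are those on projective dimension and spli in the opposite category.  Since Ext is computed from
  projective resolutions only, this duality rests on the balance of the vanishing of Ext, which is
  proved by correcting morphisms of short exact sequences by homotopies.
\<close>

section \<open>The opposite category\<close>

text \<open>The arrows themselves are kept, so \<open>opp (opp C) = C\<close> holds as an equation
  and dual statements are obtained by simplification. Note that \<open>Comp\<close> swaps its
  arguments and \<open>ZeroMor\<close> its objects.\<close>

definition opp :: "('o, 'm) precat \<Rightarrow> ('o, 'm) precat" where
  "opp C = \<lparr>Obj = Obj C, Arr = Arr C, Dom = Cod C, Cod = Dom C, Ident = Ident C,
    Comp = (\<lambda>g f. Comp C f g), Add = Add C, ZeroMor = (\<lambda>X Y. ZeroMor C Y X)\<rparr>"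

lemma opp_simps [simp]:
  "Obj (opp C) = Obj C" "Arr (opp C) = Arr C" "Dom (opp C) = Cod C" "Cod (opp C) = Dom C"
  "Ident (opp C) = Ident C" "Comp (opp C) g f = Comp C f g" "Add (opp C) = Add C"
  "ZeroMor (opp C) X Y = ZeroMor C Y X"
  by (simp_all add: opp_def)

lemma opp_opp [simp]: "opp (opp C) = C"
  by (simp add: opp_def)

lemma Hom_opp [simp]: "Hom (opp C) X Y = Hom C Y X"
  by (auto simp: Hom_def)

lemma hom_group_opp [simp]: "hom_group (opp C) X Y = hom_group C Y X"
  by (simp add: hom_group_def)

lemma zero_object_opp [simp]: "zero_object (opp C) X \<longleftrightarrow> zero_object C X"
  by (auto simp: zero_object_def)

lemma isomorphic_objects_opp [simp]: "isomorphic_objects (opp C) X Y \<longleftrightarrow> isomorphic_objects C X Y"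
  by (auto simp: isomorphic_objects_def)

lemma monic_opp [simp]: "monic (opp C) f \<longleftrightarrow> epic C f"
  by (simp add: monic_def epic_def)

lemma epic_opp [simp]: "epic (opp C) f \<longleftrightarrow> monic C f"
  by (simp add: monic_def epic_def)

lemma is_kernel_opp [simp]: "is_kernel (opp C) f k \<longleftrightarrow> is_cokernel C f k"
  by (simp add: is_kernel_def is_cokernel_def)

lemma is_cokernel_opp [simp]: "is_cokernel (opp C) f k \<longleftrightarrow> is_kernel C f k"
  by (simp add: is_kernel_def is_cokernel_def)

lemma projective_object_opp [simp]: "projective_object (opp C) X \<longleftrightarrow> injective_object C X"
  by (simp add: projective_object_def injective_object_def)

lemma injective_object_opp [simp]: "injective_object (opp C) X \<longleftrightarrow> projective_object C X"
  by (simp add: projective_object_def injective_object_def)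

lemma enough_projectives_opp [simp]: "enough_projectives (opp C) \<longleftrightarrow> enough_injectives C"
  by (simp add: enough_projectives_def enough_injectives_def)

lemma enough_injectives_opp [simp]: "enough_injectives (opp C) \<longleftrightarrow> enough_projectives C"
  by (simp add: enough_projectives_def enough_injectives_def)

lemma category_opp:
  assumes "category C"
  shows "category (opp C)"
proof -
  interpret category C by fact
  show ?thesis
    by unfold_locales
      (auto intro: dom_obj cod_obj ident_hom comp_hom comp_ident_left comp_ident_right
        simp: comp_assoc)
qed

lemma preadditive_category_opp:
  assumes "preadditive_category C"
  shows "preadditive_category (opp C)"
proof -
  interpret preadditive_category C by fact
  interpret op: category "opp C" by (rule category_opp) unfold_locales
  show ?thesis
    by (intro preadditive_category.intro preadditive_category_axioms.intro op.category_axioms)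
      (auto intro: hom_comm_group comp_add_left comp_add_right)
qed

lemma abelian_category_opp:
  assumes "abelian_category C"
  shows "abelian_category (opp C)"
proof -
  interpret abelian_category C by fact
  interpret op: preadditive_category "opp C" by (rule preadditive_category_opp) unfold_locales
  have "\<exists>B i j p q. is_biproduct (opp C) X Y B i j p q" if "X \<in> Obj C" "Y \<in> Obj C" for X Y
  proof -
    obtain B i j p q where "is_biproduct C X Y B i j p q"
      using ex_biproduct \<open>X \<in> Obj C\<close> \<open>Y \<in> Obj C\<close> by blast
    then have "is_biproduct (opp C) X Y B p q i j"
      by (auto simp: is_biproduct_def)
    then show ?thesis by blast
  qed
  then show ?thesis
    by unfold_locales
      (auto intro: ex_zero_object ex_kernel ex_cokernel monic_is_kernel epic_is_cokernel)
qed

section \<open>Exactness in abelian categories\<close>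

lemma Hom_iff: "f \<in> Hom C X Y \<longleftrightarrow> f \<in> Arr C \<and> Dom C f = X \<and> Cod C f = Y"
  by (auto simp: Hom_def)

lemma monicD:
  assumes "monic C f" "f \<in> Hom C A B" "g \<in> Hom C W A" "h \<in> Hom C W A" "Comp C f g = Comp C f h"
  shows "g = h"
proof -
  have "Dom C f = A" using assms(2) by (simp add: Hom_iff)
  then show ?thesis using assms unfolding monic_def by blast
qed

lemma epicD:
  assumes "epic C f" "f \<in> Hom C A B" "g \<in> Hom C B W" "h \<in> Hom C B W" "Comp C g f = Comp C h f"
  shows "g = h"
  using monicD[of "opp C" f B A g W h] assms by simp

context category
begin

abbreviation comp (infixl "\<cdot>" 70) where "g \<cdot> f \<equiv> Comp C g f"

lemma Hom_objD: "f \<in> Hom C X Y \<Longrightarrow> X \<in> Obj C \<and> Y \<in> Obj C"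
  using dom_obj cod_obj by (auto simp: Hom_iff)

end

context preadditive_category
begin

lemma zero_hom: "X \<in> Obj C \<Longrightarrow> Y \<in> Obj C \<Longrightarrow> ZeroMor C X Y \<in> Hom C X Y"
  using comm_group.axioms(2)[OF hom_comm_group[of X Y]] group.is_monoid monoid.one_closed
  by (fastforce simp: hom_group_def)

lemma add_cancel_zero:
  assumes "f \<in> Hom C X Y" "g \<in> Hom C X Y" "Add C f g = g"
  shows "f = ZeroMor C X Y"
proof -
  interpret G: comm_group "hom_group C X Y"
    using hom_comm_group Hom_objD[OF assms(1)] by blast
  show ?thesis
    using G.l_cancel_one[of g f] assms G.m_comm[of f g] by (simp add: hom_group_def)
qed

lemma add_zero_right:
  assumes "f \<in> Hom C X Y"
  shows "Add C f (ZeroMor C X Y) = f"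
proof -
  interpret G: comm_group "hom_group C X Y"
    using hom_comm_group Hom_objD[OF assms(1)] by blast
  show ?thesis
    using G.r_one[of f] assms by (simp add: hom_group_def)
qed

text \<open>Subtraction, with \<open>h\<close> playing the role of \<open>f - g\<close>: the record
  has no negation, so the inverse is taken from the group structure on the morphisms.\<close>

lemma ex_diff:
  assumes "f \<in> Hom C X Y" "g \<in> Hom C X Y"
  obtains h where "h \<in> Hom C X Y" "f = Add C h g"
proof -
  interpret G: comm_group "hom_group C X Y"
    using hom_comm_group Hom_objD[OF assms(1)] by blast
  let ?G = "hom_group C X Y"
  have fg: "f \<in> carrier ?G" "g \<in> carrier ?G" using assms by (simp_all add: hom_group_def)
  have "f = f \<otimes>\<^bsub>?G\<^esub> inv\<^bsub>?G\<^esub> g \<otimes>\<^bsub>?G\<^esub> g" using fg by (simp add: G.m_assoc)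
  moreover have "f \<otimes>\<^bsub>?G\<^esub> inv\<^bsub>?G\<^esub> g \<in> carrier ?G" using fg by simp
  ultimately show thesis
    using that by (simp add: hom_group_def)
qed

lemma comp_zero_right:
  assumes "g \<in> Hom C Y Z" "X \<in> Obj C"
  shows "g \<cdot> ZeroMor C X Y = ZeroMor C X Z"
proof -
  have z: "ZeroMor C X Y \<in> Hom C X Y"
    using assms zero_hom Hom_objD by blast
  have "g \<cdot> ZeroMor C X Y = Add C (g \<cdot> ZeroMor C X Y) (g \<cdot> ZeroMor C X Y)"
    using comp_add_right[OF z z assms(1)] add_zero_right[OF z] by simp
  then show ?thesis
    using add_cancel_zero[OF comp_hom[OF z assms(1)] comp_hom[OF z assms(1)]] by simp
qed

lemma comp_zero_left:
  assumes "f \<in> Hom C X Y" "Z \<in> Obj C"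
  shows "ZeroMor C Y Z \<cdot> f = ZeroMor C X Z"
proof -
  interpret op: preadditive_category "opp C" by (rule preadditive_category_opp) unfold_locales
  show ?thesis using op.comp_zero_right[of f Y X Z] assms by simp
qed

text \<open>Two morphisms with the same composite with \<open>f\<close> differ by a morphism that
  \<open>f\<close> kills, so testing against zero suffices.\<close>

lemma monicI:
  assumes f: "f \<in> Hom C A B"
    and z: "\<And>W g. g \<in> Hom C W A \<Longrightarrow> f \<cdot> g = ZeroMor C W B \<Longrightarrow> g = ZeroMor C W A"
  shows "monic C f"
proof -
  have "g = h" if g: "g \<in> Hom C W A" and h: "h \<in> Hom C W A" and e: "f \<cdot> g = f \<cdot> h" for W g h
  proof -
    obtain d where d: "d \<in> Hom C W A" "g = Add C d h" using ex_diff g h by blast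
    have "Add C (f \<cdot> d) (f \<cdot> h) = f \<cdot> h"
      using comp_add_right[OF d(1) h f] d(2) e by simp
    then have "f \<cdot> d = ZeroMor C W B"
      using add_cancel_zero comp_hom d(1) h f by blast
    then have "d = ZeroMor C W A" using z d by blast
    moreover have "Add C (ZeroMor C W A) h = h"
    proof -
      interpret G: comm_group "hom_group C W A"
        using hom_comm_group Hom_objD[OF h] by blast
      show ?thesis using G.l_one[of h] h by (simp add: hom_group_def)
    qed
    ultimately show ?thesis using d by simp
  qed
  then show ?thesis using f by (auto simp: monic_def Hom_iff)
qed

lemma epicI:
  assumes "f \<in> Hom C A B"
    and "\<And>W g. g \<in> Hom C B W \<Longrightarrow> g \<cdot> f = ZeroMor C A W \<Longrightarrow> g = ZeroMor C B W"
  shows "epic C f"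
proof -
  interpret op: preadditive_category "opp C" by (rule preadditive_category_opp) unfold_locales
  show ?thesis using op.monicI[of f B A] assms by simp
qed

lemma kernelD:
  assumes "is_kernel C f k" "f \<in> Hom C A B"
  shows "k \<in> Hom C (Dom C k) A" "monic C k" "f \<cdot> k = ZeroMor C (Dom C k) B"
    "\<And>W g. g \<in> Hom C W A \<Longrightarrow> f \<cdot> g = ZeroMor C W B \<Longrightarrow> \<exists>h \<in> Hom C W (Dom C k). k \<cdot> h = g"
proof -
  show k: "k \<in> Hom C (Dom C k) A" and z: "f \<cdot> k = ZeroMor C (Dom C k) B"
    and ex: "\<And>W g. g \<in> Hom C W A \<Longrightarrow> f \<cdot> g = ZeroMor C W B \<Longrightarrow> \<exists>h \<in> Hom C W (Dom C k). k \<cdot> h = g"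
  proof -
    have d: "Dom C f = A" "Cod C f = B" using assms(2) by (auto simp: Hom_iff)
    show "k \<in> Hom C (Dom C k) A" "f \<cdot> k = ZeroMor C (Dom C k) B"
      using assms(1) d by (auto simp: is_kernel_def Hom_iff)
    show "\<exists>h \<in> Hom C W (Dom C k). k \<cdot> h = g"
      if "g \<in> Hom C W A" "f \<cdot> g = ZeroMor C W B" for W g
      using assms(1) d that unfolding is_kernel_def by blast
  qed
  show "monic C k"
    unfolding monic_def
  proof (intro conjI allI ballI impI)
    show "k \<in> Arr C" using k by (simp add: Hom_iff)
    fix W g h
    assume g: "g \<in> Hom C W (Dom C k)" and h: "h \<in> Hom C W (Dom C k)" and e: "k \<cdot> g = k \<cdot> h"
    have "f \<cdot> (k \<cdot> g) = ZeroMor C W B"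
      using comp_assoc[OF g k assms(2)] z comp_zero_left[OF g] Hom_objD[OF assms(2)] by simp
    moreover have "k \<cdot> g \<in> Hom C W (Dom C f)"
      using comp_hom[OF g k] assms(2) by (simp add: Hom_iff)
    \<comment> \<open>Cancellation comes from uniqueness in the universal property: \<open>g\<close>
      and \<open>h\<close> are both factorisations of \<open>k \<cdot> g\<close>.\<close>
    ultimately have "\<exists>!h. h \<in> Hom C W (Dom C k) \<and> k \<cdot> h = k \<cdot> g"
      using assms unfolding is_kernel_def by (simp add: Hom_iff)
    then show "g = h" using g h e by metis
  qed
qed

lemma kernelI:
  assumes "f \<in> Hom C A B" "k \<in> Hom C K A" "monic C k" "f \<cdot> k = ZeroMor C K B"
    and "\<And>W g. g \<in> Hom C W A \<Longrightarrow> f \<cdot> g = ZeroMor C W B \<Longrightarrow> \<exists>h \<in> Hom C W K. k \<cdot> h = g"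
  shows "is_kernel C f k"
proof -
  have "\<exists>!h. h \<in> Hom C W (Dom C k) \<and> k \<cdot> h = g"
    if g: "g \<in> Hom C W (Dom C f)" "f \<cdot> g = ZeroMor C W (Cod C f)" for W g
  proof -
    have d: "Dom C f = A" "Cod C f = B" "Dom C k = K" using assms(1,2) by (auto simp: Hom_iff)
    obtain h where h: "h \<in> Hom C W K" "k \<cdot> h = g" using assms(5) g d by auto
    then have "h' = h" if "h' \<in> Hom C W K" "k \<cdot> h' = g" for h'
      using that monicD[OF assms(3,2)] by simp
    then show ?thesis using h d by auto
  qed
  moreover have "f \<in> Arr C" "k \<in> Arr C" "Cod C k = Dom C f" "Dom C k = K" "Cod C f = B"
    using assms(1,2) by (auto simp: Hom_iff)
  ultimately show ?thesis
    using assms(4) by (auto simp: is_kernel_def)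
qed

lemma cokernelD:
  assumes "is_cokernel C f c" "f \<in> Hom C A B"
  shows "c \<in> Hom C B (Cod C c)" "epic C c" "c \<cdot> f = ZeroMor C A (Cod C c)"
    "\<And>W g. g \<in> Hom C B W \<Longrightarrow> g \<cdot> f = ZeroMor C A W \<Longrightarrow> \<exists>h \<in> Hom C (Cod C c) W. h \<cdot> c = g"
proof -
  interpret op: preadditive_category "opp C" by (rule preadditive_category_opp) unfold_locales
  show "c \<in> Hom C B (Cod C c)" "epic C c" "c \<cdot> f = ZeroMor C A (Cod C c)"
    "\<And>W g. g \<in> Hom C B W \<Longrightarrow> g \<cdot> f = ZeroMor C A W \<Longrightarrow> \<exists>h \<in> Hom C (Cod C c) W. h \<cdot> c = g"
    using op.kernelD[of f c B A] assms by simp_all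
qed

lemma cokernelI:
  assumes "f \<in> Hom C A B" "c \<in> Hom C B K" "epic C c" "c \<cdot> f = ZeroMor C A K"
    and "\<And>W g. g \<in> Hom C B W \<Longrightarrow> g \<cdot> f = ZeroMor C A W \<Longrightarrow> \<exists>h \<in> Hom C K W. h \<cdot> c = g"
  shows "is_cokernel C f c"
proof -
  interpret op: preadditive_category "opp C" by (rule preadditive_category_opp) unfold_locales
  show ?thesis using op.kernelI[of f B A c K] assms by simp
qed

text \<open>The arrow \<open>f\<close> factors through the kernel \<open>k\<close> of its cokernel,
  so whatever kills \<open>k\<close> also kills \<open>f\<close> and hence factors through
  \<open>c\<close>.\<close>

lemma cokernel_of_kernel:
  assumes c: "is_cokernel C f c" and k: "is_kernel C c k"
  shows "is_cokernel C k c"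
proof -
  obtain A B where f: "f \<in> Hom C A B" using c by (auto simp: is_cokernel_def Hom_iff)
  note c' = cokernelD[OF c f]
  note k' = kernelD[OF k c'(1)]
  obtain u where u: "u \<in> Hom C A (Dom C k)" "k \<cdot> u = f" using k'(4)[OF f c'(3)] by blast
  show ?thesis
  proof (rule cokernelI[OF k'(1) c'(1,2) k'(3)])
    fix W g
    assume g: "g \<in> Hom C B W" and z: "g \<cdot> k = ZeroMor C (Dom C k) W"
    have "g \<cdot> f = ZeroMor C A W"
      using comp_assoc[OF u(1) k'(1) g] u(2) z comp_zero_left[OF u(1)] Hom_objD[OF g] by simp
    then show "\<exists>h \<in> Hom C (Cod C c) W. h \<cdot> c = g" using c'(4) g by blast
  qed
qed

end

lemma zero_object_homs:
  assumes "zero_object C Z" "X \<in> Obj C"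
  shows "f \<in> Hom C X Z \<Longrightarrow> g \<in> Hom C X Z \<Longrightarrow> f = g"
    and "f \<in> Hom C Z X \<Longrightarrow> g \<in> Hom C Z X \<Longrightarrow> f = g"
  using assms unfolding zero_object_def by blast+

text \<open>Demanding both the kernel and the cokernel property makes the notion symmetric under
  \<open>opp\<close>.\<close>

definition short_exact :: "('o, 'm) precat \<Rightarrow> 'o \<Rightarrow> 'o \<Rightarrow> 'o \<Rightarrow> 'm \<Rightarrow> 'm \<Rightarrow> bool" where
  "short_exact C K B A i q \<longleftrightarrow>
    i \<in> Hom C K B \<and> q \<in> Hom C B A \<and> is_kernel C q i \<and> is_cokernel C i q"

lemma short_exact_opp [simp]: "short_exact (opp C) K B A i q \<longleftrightarrow> short_exact C A B K q i"
  by (auto simp: short_exact_def)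

context preadditive_category
begin

lemma short_exactD:
  assumes "short_exact C K B A i q"
  shows "i \<in> Hom C K B" "q \<in> Hom C B A" "monic C i" "epic C q" "q \<cdot> i = ZeroMor C K A"
    "K \<in> Obj C" "B \<in> Obj C" "A \<in> Obj C"
    "\<And>W g. g \<in> Hom C W B \<Longrightarrow> q \<cdot> g = ZeroMor C W A \<Longrightarrow> \<exists>h \<in> Hom C W K. i \<cdot> h = g"
    "\<And>W g. g \<in> Hom C B W \<Longrightarrow> g \<cdot> i = ZeroMor C K W \<Longrightarrow> \<exists>h \<in> Hom C A W. h \<cdot> q = g"
proof -
  show i: "i \<in> Hom C K B" and q: "q \<in> Hom C B A" using assms by (auto simp: short_exact_def)
  have d: "Dom C i = K" "Cod C q = A" using i q by (auto simp: Hom_iff)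
  show "K \<in> Obj C" "B \<in> Obj C" "A \<in> Obj C" using Hom_objD i q by blast+
  have k: "is_kernel C q i" and c: "is_cokernel C i q" using assms by (auto simp: short_exact_def)
  show "monic C i" "epic C q" "q \<cdot> i = ZeroMor C K A"
    "\<And>W g. g \<in> Hom C W B \<Longrightarrow> q \<cdot> g = ZeroMor C W A \<Longrightarrow> \<exists>h \<in> Hom C W K. i \<cdot> h = g"
    "\<And>W g. g \<in> Hom C B W \<Longrightarrow> g \<cdot> i = ZeroMor C K W \<Longrightarrow> \<exists>h \<in> Hom C A W. h \<cdot> q = g"
    using kernelD[OF k q] cokernelD[OF c i] d by simp_all
qed

end

section \<open>Image factorisations and duality of exactness\<close>

context abelian_category
begin

text \<open>An epic is a cokernel of some arrow, hence also of its own kernel by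
  \<open>cokernel_of_kernel\<close>.\<close>

lemma short_exactI:
  assumes "q \<in> Hom C B A" "epic C q" "is_kernel C q i"
  shows "short_exact C (Dom C i) B A i q"
proof -
  obtain f where "is_cokernel C f q"
    using epic_is_cokernel[OF assms(2)] by blast
  then have "is_cokernel C i q" using cokernel_of_kernel assms(3) by blast
  then show ?thesis
    using assms kernelD(1)[OF assms(3,1)] by (simp add: short_exact_def)
qed

lemma image_factor:
  assumes m: "is_image C f m" and f: "f \<in> Hom C A B"
  obtains q where "q \<in> Hom C A (Dom C m)" "m \<cdot> q = f" "epic C q"
proof -
  obtain c where c: "is_cokernel C f c" and k: "is_kernel C c m"
    using m by (auto simp: is_image_def)
  note c' = cokernelD[OF c f]
  note m' = kernelD[OF k c'(1)]
  obtain q where q: "q \<in> Hom C A (Dom C m)" "m \<cdot> q = f" using m'(4) f c'(3) by blast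
  have "epic C q"
  proof (rule epicI[OF q(1)])
    fix W g
    assume g: "g \<in> Hom C (Dom C m) W" and z: "g \<cdot> q = ZeroMor C A W"
    \<comment> \<open>The aim is a right inverse of \<open>l\<close>, because
      \<open>g \<cdot> l\<close> is zero. It is found by showing that \<open>m\<close> factors
      through the smaller subobject \<open>m \<cdot> l\<close>, through which \<open>f\<close>
      already factors.\<close>
    obtain l where l: "is_kernel C g l" using ex_kernel g by (auto simp: Hom_iff)
    note l' = kernelD[OF l g]
    have ml: "m \<cdot> l \<in> Hom C (Dom C l) B" using comp_hom l'(1) m'(1) by blast
    obtain q' where q': "q' \<in> Hom C A (Dom C l)" "l \<cdot> q' = q" using l'(4)[OF q(1) z] by blast
    have "monic C (m \<cdot> l)"
    proof (rule monicI[OF ml])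
      fix V u
      assume u: "u \<in> Hom C V (Dom C l)" and zu: "m \<cdot> l \<cdot> u = ZeroMor C V B"
      have V: "V \<in> Obj C" "Dom C l \<in> Obj C" using Hom_objD[OF u] by auto
      have z: "ZeroMor C V (Dom C l) \<in> Hom C V (Dom C l)" using zero_hom V by blast
      have "m \<cdot> l \<cdot> u = m \<cdot> l \<cdot> ZeroMor C V (Dom C l)"
        using zu comp_zero_right[OF ml V(1)] by simp
      then have "m \<cdot> (l \<cdot> u) = m \<cdot> (l \<cdot> ZeroMor C V (Dom C l))"
        using comp_assoc[OF u l'(1) m'(1)] comp_assoc[OF z l'(1) m'(1)] by simp
      then have "l \<cdot> u = l \<cdot> ZeroMor C V (Dom C l)"
        using monicD[OF m'(2,1)] comp_hom[OF u l'(1)] comp_hom[OF z l'(1)] by blast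
      then show "u = ZeroMor C V (Dom C l)"
        using monicD[OF l'(2,1)] u z by blast
    qed
    \<comment> \<open>Since \<open>h\<close> kills \<open>m \<cdot> l\<close>, it kills
      \<open>f\<close> and so factors through the cokernel \<open>c\<close>. As \<open>c\<close>
      kills \<open>m\<close>, so does \<open>h\<close>, and \<open>m\<close> factors through the
      kernel \<open>m \<cdot> l\<close> of \<open>h\<close>.\<close>
    then obtain h where h: "is_kernel C h (m \<cdot> l)" using monic_is_kernel by blast
    obtain H where hH: "h \<in> Hom C B H"
      using h ml by (auto simp: is_kernel_def Hom_iff)
    note h' = kernelD[OF h hH]
    have dml: "Dom C (m \<cdot> l) = Dom C l" using ml by (simp add: Hom_iff)
    have "h \<cdot> f = h \<cdot> (m \<cdot> l) \<cdot> q'"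
      using q(2) q'(2) comp_assoc[OF q'(1) l'(1) m'(1)] comp_assoc[OF q'(1) ml hH] by simp
    also have "\<dots> = ZeroMor C A H"
      using h'(3) dml comp_zero_left[OF q'(1)] Hom_objD[OF hH] by simp
    finally obtain h2 where h2: "h2 \<in> Hom C (Cod C c) H" "h2 \<cdot> c = h" using c'(4) hH by blast
    have "h \<cdot> m = ZeroMor C (Dom C m) H"
      using comp_assoc[OF m'(1) c'(1) h2(1)] h2(2) m'(3) comp_zero_right[OF h2(1)]
        Hom_objD[OF m'(1)] by simp
    then obtain r where r: "r \<in> Hom C (Dom C m) (Dom C l)" "m \<cdot> l \<cdot> r = m"
      using h'(4) m'(1) dml by metis
    have i: "Ident C (Dom C m) \<in> Hom C (Dom C m) (Dom C m)"
      using ident_hom Hom_objD[OF m'(1)] by blast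
    have "m \<cdot> (l \<cdot> r) = m \<cdot> Ident C (Dom C m)"
      using r comp_assoc[OF r(1) l'(1) m'(1)] comp_ident_right[OF m'(1)] by simp
    then have lr: "l \<cdot> r = Ident C (Dom C m)"
      using monicD[OF m'(2,1) comp_hom[OF r(1) l'(1)] i] by blast
    have "g = g \<cdot> (l \<cdot> r)" using lr comp_ident_right[OF g] by simp
    also have "\<dots> = ZeroMor C (Dom C m) W"
      using comp_assoc[OF r(1) l'(1) g] l'(3) comp_zero_left[OF r(1)] Hom_objD[OF g] by simp
    finally show "g = ZeroMor C (Dom C m) W" .
  qed
  then show thesis using that q by blast
qed

text \<open>The image is defined asymmetrically, as a kernel of a cokernel. In the opposite category
  the witnesses \<open>m\<close> and \<open>c\<close> exchange roles: \<open>c\<close> is also a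
  cokernel of \<open>m\<close>, which is a kernel of \<open>f\<close>.\<close>

lemma exact_at_oppI:
  assumes "exact_at C g f"
  shows "exact_at (opp C) f g"
proof -
  obtain m c where "is_cokernel C g c" "is_kernel C c m" "is_kernel C f m"
    using assms by (auto simp: exact_at_def is_image_def)
  moreover from this have "is_cokernel C m c" using cokernel_of_kernel by blast
  ultimately show ?thesis
    unfolding exact_at_def is_image_def is_kernel_opp is_cokernel_opp by blast
qed

lemma exact_at_opp: "exact_at (opp C) f g \<longleftrightarrow> exact_at C g f"
proof -
  interpret op: abelian_category "opp C" by (rule abelian_category_opp) unfold_locales
  show ?thesis using exact_at_oppI op.exact_at_oppI by force
qed

lemma injective_resolution_iff:
  "injective_resolution C X I d e \<longleftrightarrow> projective_resolution (opp C) X I d e"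
  by (simp add: injective_resolution_def projective_resolution_def exact_at_opp)

lemma inj_dim_eq: "inj_dim C X = proj_dim (opp C) X"
  by (simp add: inj_dim_def proj_dim_def injective_resolution_iff)

lemma inj_dim_opp: "inj_dim (opp C) X = proj_dim C X"
proof -
  interpret op: abelian_category "opp C" by (rule abelian_category_opp) unfold_locales
  show ?thesis by (simp add: op.inj_dim_eq)
qed

lemma silp_eq: "silp C = spli (opp C)"
  by (simp add: silp_def spli_def inj_dim_eq)

end

section \<open>Balancing Ext\<close>

text \<open>Surjectivity of the restriction from \<open>Hom(B, Y)\<close> to
  \<open>Hom(K, Y)\<close>. If \<open>i\<close> is the kernel of an epic from a projective
  \<open>B\<close> to \<open>A\<close>, this is the vanishing of \<open>Ext 1 A Y\<close>. Over
  \<open>opp C\<close> the same formula expresses lifting along an arrow.\<close>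

definition extends_along :: "('o, 'm) precat \<Rightarrow> 'o \<Rightarrow> 'o \<Rightarrow> 'm \<Rightarrow> 'o \<Rightarrow> bool" where
  "extends_along C K B i Y \<longleftrightarrow> (\<forall>f \<in> Hom C K Y. \<exists>g \<in> Hom C B Y. Comp C g i = f)"

lemma projectiveD:
  assumes "projective_object C P" "epic C e" "e \<in> Hom C A B" "f \<in> Hom C P B"
  shows "\<exists>g \<in> Hom C P A. Comp C e g = f"
  using assms unfolding projective_object_def by (auto simp: Hom_iff)

lemma injectiveD:
  assumes "injective_object C I" "monic C m" "m \<in> Hom C A B" "f \<in> Hom C A I"
  shows "\<exists>g \<in> Hom C B I. Comp C g m = f"
  using projectiveD[of "opp C" I m B A f] assms by simp

context preadditive_category
begin

text \<open>
  A morphism \<open>f\<close> from the first kernel to the second extends to a morphism of short exact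
  sequences because \<open>I\<close> is injective; if its third component lifts to \<open>I\<close>, the lift is a homotopy
  that corrects the extension to one with values in \<open>Y\<close>.
\<close>

lemma extends_along_if_lifts:
  assumes KPA: "short_exact C K P A i q" and YIZ: "short_exact C Y I Z j p"
    and I: "injective_object C I" and lifts: "extends_along (opp C) Z I p A"
  shows "extends_along C K P i Y"
  unfolding extends_along_def
proof
  fix f assume f: "f \<in> Hom C K Y"
  note a = short_exactD[OF KPA] and b = short_exactD[OF YIZ]
  have jf: "j \<cdot> f \<in> Hom C K I" using comp_hom f b by blast
  obtain u where u: "u \<in> Hom C P I" "u \<cdot> i = j \<cdot> f" using injectiveD[OF I a(3,1) jf] by blast
  have pu: "p \<cdot> u \<in> Hom C P Z" using comp_hom u b by blast
  have "p \<cdot> u \<cdot> i = p \<cdot> j \<cdot> f"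
    using comp_assoc[OF a(1) u(1) b(2)] comp_assoc[OF f b(1,2)] u(2) by simp
  also have "\<dots> = ZeroMor C K Z" using b(5) comp_zero_left[OF f b(8)] by simp
  finally obtain s where s: "s \<in> Hom C A Z" "s \<cdot> q = p \<cdot> u" using a(10) pu by blast
  obtain v where v: "v \<in> Hom C A I" "p \<cdot> v = s"
    using lifts s(1) by (auto simp: extends_along_def)
  have vq: "v \<cdot> q \<in> Hom C P I" using comp_hom v a by blast
  \<comment> \<open>Subtracting the homotopy term \<open>v \<cdot> q\<close> makes the composite
    with \<open>p\<close> zero, so \<open>w\<close> factors through \<open>j\<close>; the
    restriction to \<open>K\<close> is unchanged because \<open>q \<cdot> i\<close> is zero.\<close>
  obtain w where w: "w \<in> Hom C P I" "u = Add C w (v \<cdot> q)" using ex_diff u(1) vq by blast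
  have "Add C (p \<cdot> w) (p \<cdot> (v \<cdot> q)) = p \<cdot> u" using comp_add_right[OF w(1) vq b(2)] w(2) by simp
  also have "\<dots> = p \<cdot> (v \<cdot> q)" using s v comp_assoc[OF a(2) v(1) b(2)] by simp
  finally have "p \<cdot> w = ZeroMor C P Z" using add_cancel_zero comp_hom w(1) vq b(2) by blast
  then obtain g where g: "g \<in> Hom C P Y" "j \<cdot> g = w" using b(9) w(1) by blast
  have "j \<cdot> f = Add C (w \<cdot> i) (v \<cdot> q \<cdot> i)"
    using u(2) w(2) comp_add_left[OF a(1) w(1) vq] by simp
  also have "v \<cdot> q \<cdot> i = ZeroMor C K I"
    using comp_assoc[OF a(1,2) v(1)] a(5) comp_zero_right[OF v(1) a(6)] by simp
  also have "Add C (w \<cdot> i) (ZeroMor C K I) = w \<cdot> i"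
    using add_zero_right comp_hom[OF a(1) w(1)] by blast
  also have "\<dots> = j \<cdot> (g \<cdot> i)" using g comp_assoc[OF a(1) g(1) b(1)] by simp
  finally have "f = g \<cdot> i" using monicD[OF b(3,1)] f comp_hom[OF a(1) g(1)] by blast
  then show "\<exists>g \<in> Hom C P Y. g \<cdot> i = f" using g by blast
qed

text \<open>Both sides express the vanishing of \<open>Ext 1 A Y\<close>, once by a projective
  presentation of \<open>A\<close> and once by an injective copresentation of \<open>Y\<close>. The
  converse is the previous lemma in \<open>opp C\<close> with the two sequences
  interchanged.\<close>

lemma extends_along_iff_lifts:
  assumes "short_exact C K P A i q" "short_exact C Y I Z j p"
    and "projective_object C P" "injective_object C I"
  shows "extends_along C K P i Y \<longleftrightarrow> extends_along (opp C) Z I p A"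
proof -
  interpret op: preadditive_category "opp C" by (rule preadditive_category_opp) unfold_locales
  show ?thesis
    using extends_along_if_lifts[of K P A i q Y I Z j p]
      op.extends_along_if_lifts[of Z I Y p j A P K q i] assms by auto
qed

text \<open>Extend a morphism from \<open>K\<close> to all of \<open>P\<close>, lift the extension
  by projectivity of \<open>P\<close>, and restrict the lift to \<open>K\<close> again.\<close>

lemma lifts_if_extends_along:
  assumes KPA: "short_exact C K P A i q" and YIZ: "short_exact C Y I Z j p"
    and P: "projective_object C P" and ext: "extends_along C K P i Z"
  shows "extends_along (opp C) Z I p K"
  unfolding extends_along_def
proof
  fix f assume "f \<in> Hom (opp C) Z K"
  then have f: "f \<in> Hom C K Z" by simp
  note a = short_exactD[OF KPA] and b = short_exactD[OF YIZ]
  obtain g where g: "g \<in> Hom C P Z" "g \<cdot> i = f" using ext f by (auto simp: extends_along_def)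
  obtain h where h: "h \<in> Hom C P I" "p \<cdot> h = g" using projectiveD[OF P b(4,2) g(1)] by blast
  have "p \<cdot> (h \<cdot> i) = f" using comp_assoc[OF a(1) h(1) b(2)] h(2) g(2) by simp
  then show "\<exists>g \<in> Hom (opp C) I K. Comp (opp C) g p = f"
    using comp_hom[OF a(1) h(1)] by auto
qed

text \<open>Dimension shifting: the left side is the vanishing of \<open>Ext 1 K Y\<close>, the
  right side that of \<open>Ext 1 A Z\<close>, and both groups are \<open>Ext 2 A Y\<close>.\<close>

lemma lifts_iff_extends_along:
  assumes "short_exact C K P A i q" "short_exact C Y I Z j p"
    and "projective_object C P" "injective_object C I"
  shows "extends_along (opp C) Z I p K \<longleftrightarrow> extends_along C K P i Z"
proof -
  interpret op: preadditive_category "opp C" by (rule preadditive_category_opp) unfold_locales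
  show ?thesis
    using lifts_if_extends_along[of K P A i q Y I Z j p]
      op.lifts_if_extends_along[of Z I Y p j A P K q i] assms by auto
qed

end

text \<open>A projective resolution of \<open>X\<close>, cut into short exact sequences of syzygies \<open>K n\<close>.\<close>

definition syzygy_chain ::
  "('o, 'm) precat \<Rightarrow> 'o \<Rightarrow> (nat \<Rightarrow> 'o) \<Rightarrow> (nat \<Rightarrow> 'o) \<Rightarrow> (nat \<Rightarrow> 'm) \<Rightarrow> (nat \<Rightarrow> 'm) \<Rightarrow> bool" where
  "syzygy_chain C X K P i q \<longleftrightarrow> K 0 = X \<and>
    (\<forall>n. projective_object C (P n) \<and> short_exact C (K (Suc n)) (P n) (K n) (i n) (q n))"

lemma syzygy_chainD:
  assumes "syzygy_chain C X K P i q"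
  shows "K 0 = X" "projective_object C (P n)"
    "short_exact C (K (Suc n)) (P n) (K n) (i n) (q n)"
  using assms by (auto simp: syzygy_chain_def)

text \<open>Over \<open>opp C\<close> a chain is an injective resolution of \<open>Y\<close> cut
  into cosyzygies \<open>Z n\<close>; its two families of maps are then the epics \<open>p\<close>
  and the monics \<open>j\<close>, in this order.\<close>

lemma cosyzygy_chainD:
  assumes "syzygy_chain (opp C) Y Z I p j"
  shows "Z 0 = Y" "injective_object C (I n)"
    "short_exact C (Z n) (I n) (Z (Suc n)) (j n) (p n)"
  using syzygy_chainD[OF assms] by auto

text \<open>The vanishing of \<open>Ext (n + 1)\<close>; see \<open>trivial_Ext_iff\<close>.\<close>

definition ext_vanishes :: "('o, 'm) precat \<Rightarrow> nat \<Rightarrow> 'o \<Rightarrow> 'o \<Rightarrow> bool" where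
  "ext_vanishes C n X Y \<longleftrightarrow> (\<forall>K P i q. syzygy_chain C X K P i q \<longrightarrow>
    extends_along C (K (Suc n)) (P n) (i n) Y)"

text \<open>A zigzag of the two preceding equivalences lowers the syzygy index by one and raises the
  cosyzygy index by one, until all of the shift has moved to the second argument.\<close>

lemma (in preadditive_category) syzygy_chain_balance:
  assumes K: "syzygy_chain C X K P i q" and Z: "syzygy_chain (opp C) Y Z I p j"
  shows "extends_along C (K (Suc n)) (P n) (i n) Y \<longleftrightarrow>
    extends_along (opp C) (Z (Suc n)) (I n) (p n) X"
proof -
  note k = syzygy_chainD[OF K] and z = cosyzygy_chainD[OF Z]
  \<comment> \<open>In terms of Ext, vanishing of \<open>Ext (n + 1) X (Z b)\<close> becomes that of
    \<open>Ext 1 X (Z (n + b))\<close>. The index \<open>b\<close> varies in the induction because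
    each step moves to the next cosyzygy.\<close>
  have "extends_along C (K (Suc n)) (P n) (i n) (Z b) \<longleftrightarrow>
    extends_along C (K (Suc 0)) (P 0) (i 0) (Z (n + b))" for b
  proof (induction n arbitrary: b)
    case (Suc n)
    have "extends_along C (K (Suc (Suc n))) (P (Suc n)) (i (Suc n)) (Z b) \<longleftrightarrow>
      extends_along (opp C) (Z (Suc b)) (I b) (p b) (K (Suc n))"
      using extends_along_iff_lifts k z by blast
    also have "\<dots> \<longleftrightarrow> extends_along C (K (Suc n)) (P n) (i n) (Z (Suc b))"
      using lifts_iff_extends_along k z by blast
    finally show ?case using Suc.IH[of "Suc b"] by simp
  qed simp
  from this[of 0] show ?thesis
    using extends_along_iff_lifts[OF k(3) z(3) k(2) z(2), of 0 n] k(1) z(1) by simp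
qed

section \<open>Existence of resolutions and independence of their choice\<close>

locale enough_category = abelian_category C for C :: "('o, 'm) precat" +
  assumes projectives: "enough_projectives C" and injectives: "enough_injectives C"
begin

lemma enough_category_opp: "enough_category (opp C)"
proof -
  interpret op: abelian_category "opp C" by (rule abelian_category_opp) unfold_locales
  show ?thesis using projectives injectives by unfold_locales auto
qed

lemma ex_syzygy:
  assumes "X \<in> Obj C"
  shows "\<exists>K P i q. projective_object C P \<and> short_exact C K P X i q"
proof -
  obtain P e where P: "projective_object C P" "e \<in> Hom C P X" "epic C e"
    using projectives assms by (auto simp: enough_projectives_def)
  obtain k where "is_kernel C e k" using ex_kernel P(2) by (auto simp: Hom_iff)
  then show ?thesis using short_exactI P by blast
qed

lemma ex_syzygy_chain:
  assumes "X \<in> Obj C"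
  shows "\<exists>K P i q. syzygy_chain C X K P i q"
proof -
  \<comment> \<open>A presentation is chosen once for every object; the chain arises by iterating
    the syzygy function \<open>K\<close> from \<open>X\<close>.\<close>
  obtain K P i q where s: "projective_object C (P A)" "short_exact C (K A) (P A) A (i A) (q A)"
    if "A \<in> Obj C" for A
    using ex_syzygy by metis
  have K: "(K ^^ n) X \<in> Obj C" for n
    using assms short_exactD(6)[OF s(2)] by (induction n) auto
  then have "syzygy_chain C X (\<lambda>n. (K ^^ n) X) (\<lambda>n. P ((K ^^ n) X))
    (\<lambda>n. i ((K ^^ n) X)) (\<lambda>n. q ((K ^^ n) X))"
    using s by (auto simp: syzygy_chain_def)
  then show ?thesis by blast
qed

lemma ex_cosyzygy_chain: "X \<in> Obj C \<Longrightarrow> \<exists>Z I p j. syzygy_chain (opp C) X Z I p j"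
  using enough_category.ex_syzygy_chain[OF enough_category_opp] by simp

text \<open>Any two syzygy chains of \<open>X\<close> are compared through one fixed cosyzygy chain
  of \<open>Y\<close>, which replaces comparison maps between projective resolutions.\<close>

lemma ext_vanishes_iff:
  assumes "syzygy_chain C X K P i q" "Y \<in> Obj C"
  shows "ext_vanishes C n X Y \<longleftrightarrow> extends_along C (K (Suc n)) (P n) (i n) Y"
proof -
  obtain Z I p j where Z: "syzygy_chain (opp C) Y Z I p j" using ex_cosyzygy_chain assms(2) by blast
  have "extends_along C (K' (Suc n)) (P' n) (i' n) Y \<longleftrightarrow>
      extends_along C (K (Suc n)) (P n) (i n) Y"
    if "syzygy_chain C X K' P' i' q'" for K' P' i' q'
    using syzygy_chain_balance[OF that Z] syzygy_chain_balance[OF assms(1) Z] by simp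
  then show ?thesis
    using assms(1) unfolding ext_vanishes_def by blast
qed

lemma ext_vanishes_iff_lifts:
  assumes "syzygy_chain (opp C) Y Z I p j" "X \<in> Obj C" "Y \<in> Obj C"
  shows "ext_vanishes C n X Y \<longleftrightarrow> extends_along (opp C) (Z (Suc n)) (I n) (p n) X"
  using ext_vanishes_iff ex_syzygy_chain[OF assms(2)] syzygy_chain_balance assms by metis

text \<open>Balance in the form used for duality: lifting along a cosyzygy chain of \<open>Y\<close>
  is the extension condition for that chain in \<open>opp C\<close>.\<close>

lemma ext_vanishes_opp:
  assumes "X \<in> Obj C" "Y \<in> Obj C"
  shows "ext_vanishes (opp C) n Y X \<longleftrightarrow> ext_vanishes C n X Y"
  using ext_vanishes_iff_lifts enough_category.ext_vanishes_iff[OF enough_category_opp]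
    ex_cosyzygy_chain[OF assms(2)] assms by (metis opp_simps(1))

lemma ext_vanishes_iso:
  assumes "isomorphic_objects C Y Y'" "ext_vanishes C n X Y"
  shows "ext_vanishes C n X Y'"
proof -
  obtain a b where a: "a \<in> Hom C Y Y'" and b: "b \<in> Hom C Y' Y" and ab: "a \<cdot> b = Ident C Y'"
    using assms(1) by (auto simp: isomorphic_objects_def)
  show ?thesis
    unfolding ext_vanishes_def extends_along_def
  proof (intro allI impI ballI)
    fix K P i q f
    assume K: "syzygy_chain C X K P i q" and f: "f \<in> Hom C (K (Suc n)) Y'"
    have i: "i n \<in> Hom C (K (Suc n)) (P n)" using syzygy_chainD(3)[OF K] short_exactD(1) by blast
    obtain g where g: "g \<in> Hom C (P n) Y" "g \<cdot> i n = b \<cdot> f"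
      using assms(2) K comp_hom[OF f b] unfolding ext_vanishes_def extends_along_def by blast
    have "a \<cdot> g \<cdot> i n = f"
      using comp_assoc[OF i g(1) a] g(2) comp_assoc[OF f b a] ab comp_ident_left[OF f] by simp
    then show "\<exists>g \<in> Hom C (P n) Y'. g \<cdot> i n = f" using comp_hom[OF g(1) a] by blast
  qed
qed

end

section \<open>Dimensions and vanishing of Ext\<close>

context abelian_category
begin

text \<open>Splicing: composing with the epic \<open>q (Suc n)\<close> does not change the cokernel
  of \<open>i n\<close>, and composing with the monic \<open>i n\<close> does not change the kernel
  of \<open>q (Suc n)\<close>.\<close>

lemma syzygy_chain_resolution:
  assumes "syzygy_chain C X K P i q"
  shows "projective_resolution C X P (\<lambda>n. i n \<cdot> q (Suc n)) (q 0)"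
proof -
  note k = syzygy_chainD[OF assms]
  note s = short_exactD[OF k(3)]
  have "is_cokernel C (i n \<cdot> q (Suc n)) (q n)" for n
  proof (rule cokernelI)
    show "i n \<cdot> q (Suc n) \<in> Hom C (P (Suc n)) (P n)" using comp_hom s by blast
    show "q n \<in> Hom C (P n) (K n)" "epic C (q n)" using s by blast+
    show "q n \<cdot> (i n \<cdot> q (Suc n)) = ZeroMor C (P (Suc n)) (K n)"
      using comp_assoc[OF s(2) s(1) s(2)] s(5) comp_zero_left[OF s(2) s(8)] by simp
    fix W g
    assume g: "g \<in> Hom C (P n) W" and z: "g \<cdot> (i n \<cdot> q (Suc n)) = ZeroMor C (P (Suc n)) W"
    have W: "W \<in> Obj C" using Hom_objD g by blast
    have "g \<cdot> i n \<cdot> q (Suc n) = ZeroMor C (K (Suc n)) W \<cdot> q (Suc n)"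
      using comp_assoc[OF s(2) s(1) g] z comp_zero_left[OF s(2) W] by simp
    then have "g \<cdot> i n = ZeroMor C (K (Suc n)) W"
      using epicD[OF s(4,2) comp_hom[OF s(1) g] zero_hom[OF s(6) W]] by blast
    then show "\<exists>h \<in> Hom C (K n) W. h \<cdot> q n = g" using s(10) g by blast
  qed
  then have im: "is_image C (i n \<cdot> q (Suc n)) (i n)" for n
    using k(3) unfolding is_image_def short_exact_def by blast
  have ker: "is_kernel C (q n) (i n)" for n using k(3) by (auto simp: short_exact_def)
  have "is_kernel C (i n \<cdot> q (Suc n)) (i (Suc n))" for n
  proof (rule kernelI)
    show d: "i n \<cdot> q (Suc n) \<in> Hom C (P (Suc n)) (P n)" using comp_hom s by blast
    show "i (Suc n) \<in> Hom C (K (Suc (Suc n))) (P (Suc n))" "monic C (i (Suc n))" using s by blast+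
    show "i n \<cdot> q (Suc n) \<cdot> i (Suc n) = ZeroMor C (K (Suc (Suc n))) (P n)"
      using comp_assoc[OF s(1) s(2) s(1)] s(5) comp_zero_right[OF s(1) s(6)] by simp
    fix W g
    assume g: "g \<in> Hom C W (P (Suc n))" and z: "i n \<cdot> q (Suc n) \<cdot> g = ZeroMor C W (P n)"
    have W: "W \<in> Obj C" using Hom_objD g by blast
    have "i n \<cdot> (q (Suc n) \<cdot> g) = i n \<cdot> ZeroMor C W (K (Suc n))"
      using comp_assoc[OF g s(2) s(1)] z comp_zero_right[OF s(1) W] by simp
    then have "q (Suc n) \<cdot> g = ZeroMor C W (K (Suc n))"
      using monicD[OF s(3,1) comp_hom[OF g s(2)] zero_hom[OF W s(6)]] by blast
    then show "\<exists>h \<in> Hom C W (K (Suc (Suc n))). i (Suc n) \<cdot> h = g" using s(9) g by blast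
  qed
  moreover have "i n \<cdot> q (Suc n) \<in> Hom C (P (Suc n)) (P n)" for n using comp_hom s by blast
  moreover have "q 0 \<in> Hom C (P 0) X" using s(2)[of 0] k(1) by simp
  ultimately show ?thesis
    using im ker k s(4) unfolding projective_resolution_def exact_at_def by blast
qed

text \<open>The converse of splicing: each differential is factored through its image, and these
  images are the syzygies.\<close>

lemma projective_resolution_chain:
  assumes "projective_resolution C X P d e"
  obtains K i q where "syzygy_chain C X K P i q" "d = (\<lambda>n. i n \<cdot> q (Suc n))"
proof -
  have P: "projective_object C (P n)" and d: "d n \<in> Hom C (P (Suc n)) (P n)"
    and e: "e \<in> Hom C (P 0) X" "epic C e" for n
    using assms by (auto simp: projective_resolution_def)
  \<comment> \<open>The case distinction gives the map that follows \<open>d n\<close> in the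
    resolution, which for \<open>d 0\<close> is the augmentation.\<close>
  have "\<exists>m. is_image C (d n) m \<and> is_kernel C (case n of 0 \<Rightarrow> e | Suc k \<Rightarrow> d k) m" for n
    using assms unfolding projective_resolution_def exact_at_def by (cases n) auto
  then obtain m where m: "is_image C (d n) (m n)"
    and km: "is_kernel C (case n of 0 \<Rightarrow> e | Suc k \<Rightarrow> d k) (m n)" for n by metis
  have "\<exists>r. r \<in> Hom C (P (Suc n)) (Dom C (m n)) \<and> m n \<cdot> r = d n \<and> epic C r" for n
    by (rule image_factor[OF m d]) blast
  then obtain r where r: "r n \<in> Hom C (P (Suc n)) (Dom C (m n))" "m n \<cdot> r n = d n" "epic C (r n)" for n
    by metis
  define K where "K n = (case n of 0 \<Rightarrow> X | Suc k \<Rightarrow> Dom C (m k))" for n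
  define q where "q n = (case n of 0 \<Rightarrow> e | Suc k \<Rightarrow> r k)" for n
  have q: "q n \<in> Hom C (P n) (K n)" "epic C (q n)" for n
    using e r by (auto simp: q_def K_def split: nat.split)
  have "is_kernel C (q n) (m n)" for n
  proof (cases n)
    case 0
    then show ?thesis using km[of 0] by (simp add: q_def)
  next
    case (Suc k)
    have "is_kernel C (d k) (m n)" using km[of n] Suc by simp
    note a = kernelD[OF this d]
    obtain B where f: "(case k of 0 \<Rightarrow> e | Suc l \<Rightarrow> d l) \<in> Hom C (P k) B"
      using e d by (cases k) auto
    note b = kernelD[OF km[of k] f]
    \<comment> \<open>Since \<open>m k\<close> is monic, \<open>r k\<close> and
      \<open>d k = m k \<cdot> r k\<close> are killed by the same arrows.\<close>
    have "is_kernel C (r k) (m n)"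
    proof (rule kernelI[OF r(1) a(1,2)])
      have D: "Dom C (m n) \<in> Obj C" "Dom C (m k) \<in> Obj C" using Hom_objD a(1) b(1) by blast+
      have "m k \<cdot> (r k \<cdot> m n) = m k \<cdot> ZeroMor C (Dom C (m n)) (Dom C (m k))"
        using comp_assoc[OF a(1) r(1) b(1)] r(2) a(3) comp_zero_right[OF b(1) D(1)] by simp
      then show "r k \<cdot> m n = ZeroMor C (Dom C (m n)) (Dom C (m k))"
        using monicD[OF b(2,1) comp_hom[OF a(1) r(1)] zero_hom[OF D]] by blast
      fix W g
      assume g: "g \<in> Hom C W (P (Suc k))" and z: "r k \<cdot> g = ZeroMor C W (Dom C (m k))"
      have "d k \<cdot> g = ZeroMor C W (P k)"
        using comp_assoc[OF g r(1) b(1)] r(2) z comp_zero_right[OF b(1)] Hom_objD[OF g] by simp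
      then show "\<exists>h \<in> Hom C W (Dom C (m n)). m n \<cdot> h = g" using a(4) g by blast
    qed
    then show ?thesis using Suc by (simp add: q_def)
  qed
  then have "short_exact C (K (Suc n)) (P n) (K n) (m n) (q n)" for n
    using short_exactI q by (simp add: K_def)
  then have "syzygy_chain C X K P m q" using P by (simp add: syzygy_chain_def K_def)
  moreover have "d n = m n \<cdot> q (Suc n)" for n using r(2) by (simp add: q_def)
  ultimately show thesis using that by blast
qed

section \<open>Truncation of a resolution at a projective syzygy\<close>

lemma short_exact_ident:
  assumes Z: "zero_object C Z" and A: "A \<in> Obj C"
  shows "short_exact C Z A A (ZeroMor C Z A) (Ident C A)"
proof -
  have Zo: "Z \<in> Obj C" using Z by (simp add: zero_object_def)
  note o = zero_hom[OF Zo A] and i = ident_hom[OF A]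
  have k: "is_kernel C (Ident C A) (ZeroMor C Z A)"
  proof (rule kernelI[OF i o])
    show "monic C (ZeroMor C Z A)"
      by (rule monicI[OF o]) (use zero_object_homs(1)[OF Z] Hom_objD zero_hom in blast)
    show "Ident C A \<cdot> ZeroMor C Z A = ZeroMor C Z A" using comp_ident_left o by blast
    fix W g
    assume g: "g \<in> Hom C W A" and z: "Ident C A \<cdot> g = ZeroMor C W A"
    have W: "W \<in> Obj C" using Hom_objD g by blast
    have "ZeroMor C Z A \<cdot> ZeroMor C W Z = g"
      using z comp_ident_left[OF g] comp_zero_right[OF o W] by simp
    then show "\<exists>h \<in> Hom C W Z. ZeroMor C Z A \<cdot> h = g" using zero_hom[OF W Zo] by blast
  qed
  moreover have "epic C (Ident C A)"
    by (rule epicI[OF i]) (simp add: comp_ident_right)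
  ultimately show ?thesis using short_exactI[OF i _ k] o by (simp add: Hom_iff)
qed

lemma zero_object_projective:
  assumes Z: "zero_object C Z"
  shows "projective_object C Z"
  unfolding projective_object_def
proof (intro conjI allI impI ballI)
  show Zo: "Z \<in> Obj C" using Z by (simp add: zero_object_def)
  fix e f assume "epic C e" and f: "f \<in> Hom C Z (Cod C e)"
  then have e: "e \<in> Hom C (Dom C e) (Cod C e)" by (simp add: epic_def Hom_iff)
  note o = zero_hom[OF Zo, of "Dom C e"]
  have "e \<cdot> ZeroMor C Z (Dom C e) = f"
    using zero_object_homs(2)[OF Z _ comp_hom[OF o e] f] Hom_objD[OF e] by blast
  then show "\<exists>g \<in> Hom C Z (Dom C e). e \<cdot> g = f" using o Hom_objD[OF e] by blast
qed

text \<open>Extending the identity of \<open>K\<close> to \<open>P\<close> splits the sequence, so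
  \<open>A\<close> is a retract of the projective \<open>P\<close>.\<close>

lemma projective_if_split:
  assumes s: "short_exact C K P A i q" and P: "projective_object C P"
    and ext: "extends_along C K P i K"
  shows "projective_object C A"
proof -
  note s = short_exactD[OF s]
  obtain r where r: "r \<in> Hom C P K" "r \<cdot> i = Ident C K"
    using ext ident_hom[OF s(6)] by (auto simp: extends_along_def)
  have ir: "i \<cdot> r \<in> Hom C P P" using comp_hom r s by blast
  \<comment> \<open>The complement \<open>w\<close> of \<open>i \<cdot> r\<close> kills
    \<open>i\<close> and therefore factors through \<open>q\<close>; the factor \<open>t\<close> is
    a section of \<open>q\<close>.\<close>
  obtain w where w: "w \<in> Hom C P P" "Ident C P = Add C w (i \<cdot> r)"
    using ex_diff ident_hom[OF s(7)] ir by blast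
  have "i = Ident C P \<cdot> i" using comp_ident_left[OF s(1)] by simp
  also have "\<dots> = Add C (w \<cdot> i) (i \<cdot> r \<cdot> i)" using w comp_add_left[OF s(1) w(1) ir] by simp
  also have "i \<cdot> r \<cdot> i = i" using comp_assoc[OF s(1) r(1) s(1)] r(2) comp_ident_right[OF s(1)] by simp
  finally have "w \<cdot> i = ZeroMor C K P"
    using add_cancel_zero[OF comp_hom[OF s(1) w(1)] s(1)] by simp
  then obtain t where t: "t \<in> Hom C A P" "t \<cdot> q = w" using s(10) w(1) by blast
  have "q = q \<cdot> Ident C P" using comp_ident_right[OF s(2)] by simp
  also have "\<dots> = Add C (q \<cdot> w) (q \<cdot> (i \<cdot> r))" using w comp_add_right[OF w(1) ir s(2)] by simp
  also have "q \<cdot> (i \<cdot> r) = ZeroMor C P A"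
    using comp_assoc[OF r(1) s(1,2)] s(5) comp_zero_left[OF r(1) s(8)] by simp
  also have "Add C (q \<cdot> w) (ZeroMor C P A) = q \<cdot> w"
    using add_zero_right comp_hom[OF w(1) s(2)] by blast
  also have "\<dots> = q \<cdot> t \<cdot> q" using t comp_assoc[OF s(2) t(1) s(2)] by simp
  finally have "q \<cdot> t \<cdot> q = Ident C A \<cdot> q" using comp_ident_left[OF s(2)] by simp
  then have qt: "q \<cdot> t = Ident C A"
    using epicD[OF s(4,2) comp_hom[OF t(1) s(2)] ident_hom[OF s(8)]] by blast
  show ?thesis
    unfolding projective_object_def
  proof (intro conjI allI impI ballI)
    fix e f assume e: "epic C e" and f: "f \<in> Hom C A (Cod C e)"
    then have eh: "e \<in> Hom C (Dom C e) (Cod C e)" by (simp add: epic_def Hom_iff)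
    obtain g where g: "g \<in> Hom C P (Dom C e)" "e \<cdot> g = f \<cdot> q"
      using projectiveD[OF P e eh comp_hom[OF s(2) f]] by blast
    have "e \<cdot> (g \<cdot> t) = f"
      using comp_assoc[OF t(1) g(1) eh] g(2) comp_assoc[OF t(1) s(2) f] qt comp_ident_right[OF f]
      by simp
    then show "\<exists>g \<in> Hom C A (Dom C e). e \<cdot> g = f" using comp_hom[OF t(1) g(1)] by blast
  qed (fact s(8))
qed

text \<open>By the hypothesis \<open>K m\<close> is projective, so it can resolve itself from degree
  \<open>m\<close> on.\<close>

lemma truncate_syzygy_chain:
  assumes K: "syzygy_chain C X K P i q"
    and ext: "extends_along C (K (Suc m)) (P m) (i m) (K (Suc m))"
  obtains K' P' i' q' where "syzygy_chain C X K' P' i' q'" "\<And>n. n > m \<Longrightarrow> zero_object C (K' n)"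
    "\<And>n. n > m \<Longrightarrow> zero_object C (P' n)"
proof -
  obtain Z where Z: "zero_object C Z" using ex_zero_object by blast
  note k = syzygy_chainD[OF K]
  have Ko: "K m \<in> Obj C" using short_exactD(8)[OF k(3)] .
  have Zo: "Z \<in> Obj C" using Z by (simp add: zero_object_def)
  have Km: "projective_object C (K m)" using projective_if_split[OF k(3,2) ext] .
  \<comment> \<open>\<open>K'\<close> keeps one more index than \<open>P'\<close>: the projective in
    degree \<open>m\<close> is now \<open>K m\<close> itself, mapped by the identity, with zero
    kernel.\<close>
  define K' where "K' n = (if n \<le> m then K n else Z)" for n
  define P' where "P' n = (if n < m then P n else K' n)" for n
  define i' where "i' n = (if n < m then i n else ZeroMor C Z (K' n))" for n
  define q' where "q' n = (if n < m then q n else Ident C (K' n))" for n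
  have "projective_object C (P' n)" for n
    using k(2) Km zero_object_projective[OF Z] by (auto simp: P'_def K'_def dest: le_neq_implies_less)
  moreover have "short_exact C (K' (Suc n)) (P' n) (K' n) (i' n) (q' n)" for n
  proof (cases "n < m")
    case True
    then show ?thesis using k(3)[of n] by (simp add: K'_def P'_def i'_def q'_def)
  next
    case False
    then have "K' n \<in> Obj C" using Ko Zo by (auto simp: K'_def dest: le_neq_implies_less)
    then show ?thesis
      using short_exact_ident[OF Z, of "K' n"] False by (simp add: K'_def P'_def i'_def q'_def)
  qed
  ultimately have "syzygy_chain C X K' P' i' q'"
    using k(1) by (simp add: syzygy_chain_def K'_def)
  then show thesis by (rule that) (simp_all add: P'_def K'_def Z)
qed

end

text \<open>A finite infimum in \<open>enat\<close> is attained, and a resolution that is zero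
  beyond a smaller length is also zero beyond \<open>m\<close>.\<close>

lemma proj_dim_le_iff:
  "proj_dim C X \<le> enat m \<longleftrightarrow>
    (\<exists>P d e. projective_resolution C X P d e \<and> (\<forall>i>m. zero_object C (P i)))"
proof
  let ?S = "{enat n |n. \<exists>P d e. projective_resolution C X P d e \<and> (\<forall>i>n. zero_object C (P i))}"
  assume le: "proj_dim C X \<le> enat m"
  have "?S \<noteq> {}"
  proof
    assume "?S = {}"
    then have "proj_dim C X = \<infinity>" unfolding proj_dim_def Inf_enat_def by (simp only: simp_thms if_True)
    with le show False by simp
  qed
  then have "Inf ?S \<in> ?S" unfolding Inf_enat_def by (metis (no_types, lifting) LeastI ex_in_conv)
  with le show "\<exists>P d e. projective_resolution C X P d e \<and> (\<forall>i>m. zero_object C (P i))"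
    unfolding proj_dim_def by force
next
  assume "\<exists>P d e. projective_resolution C X P d e \<and> (\<forall>i>m. zero_object C (P i))"
  then show "proj_dim C X \<le> enat m" unfolding proj_dim_def by (intro Inf_lower) blast
qed

section \<open>Dimension bounds as vanishing of Ext\<close>

context enough_category
begin

lemma ex_finite_syzygy_chain:
  assumes X: "X \<in> Obj C" and van: "\<And>Y. Y \<in> Obj C \<Longrightarrow> ext_vanishes C m X Y"
  shows "\<exists>K P i q. syzygy_chain C X K P i q \<and> (\<forall>n>m. zero_object C (K n) \<and> zero_object C (P n))"
proof -
  obtain K P i q where K: "syzygy_chain C X K P i q" using ex_syzygy_chain X by blast
  have "K (Suc m) \<in> Obj C" using short_exactD(6)[OF syzygy_chainD(3)[OF K]] .
  \<comment> \<open>The test object is the syzygy \<open>K (Suc m)\<close> itself, so that its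
    identity extends to \<open>P m\<close>.\<close>
  then have "extends_along C (K (Suc m)) (P m) (i m) (K (Suc m))"
    using van ext_vanishes_iff[OF K] by blast
  then show ?thesis by (rule truncate_syzygy_chain[OF K]) blast
qed

text \<open>As \<open>ext_vanishes C n\<close> concerns degree \<open>n + 1\<close>, the range
  \<open>n \<ge> m\<close> means all degrees above \<open>m\<close>.\<close>

lemma proj_dim_le_iff_ext_vanishes:
  assumes "X \<in> Obj C"
  shows "proj_dim C X \<le> enat m \<longleftrightarrow> (\<forall>n\<ge>m. \<forall>Y \<in> Obj C. ext_vanishes C n X Y)"
proof
  assume "proj_dim C X \<le> enat m"
  then obtain P d e where P: "projective_resolution C X P d e" and z: "\<forall>i>m. zero_object C (P i)"
    unfolding proj_dim_le_iff by blast
  obtain K i q where K: "syzygy_chain C X K P i q" by (rule projective_resolution_chain[OF P])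
  note s = short_exactD[OF syzygy_chainD(3)[OF K]]
  have "ext_vanishes C n X Y" if "n \<ge> m" and Y: "Y \<in> Obj C" for n Y
    unfolding ext_vanishes_iff[OF K Y] extends_along_def
  proof
    fix f assume f: "f \<in> Hom C (K (Suc n)) Y"
    \<comment> \<open>All morphisms from \<open>P (Suc n)\<close> to \<open>Y\<close> agree, and
      \<open>q (Suc n)\<close> is epic, so \<open>f\<close> is the restriction of the zero
      morphism.\<close>
    have Pz: "zero_object C (P (Suc n))" using z that by simp
    have o: "ZeroMor C (P n) Y \<in> Hom C (P n) Y" using zero_hom s(7) Y by blast
    note oi = comp_hom[OF s(1) o]
    have "f \<cdot> q (Suc n) = ZeroMor C (P n) Y \<cdot> i n \<cdot> q (Suc n)"
      using zero_object_homs(2)[OF Pz Y comp_hom[OF s(2) f] comp_hom[OF s(2) oi]] .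
    then have "f = ZeroMor C (P n) Y \<cdot> i n" using epicD[OF s(4,2) f oi] by blast
    then show "\<exists>g \<in> Hom C (P n) Y. g \<cdot> i n = f" using o by blast
  qed
  then show "\<forall>n\<ge>m. \<forall>Y \<in> Obj C. ext_vanishes C n X Y" by blast
next
  assume "\<forall>n\<ge>m. \<forall>Y \<in> Obj C. ext_vanishes C n X Y"
  then obtain K P i q where "syzygy_chain C X K P i q" "\<forall>n>m. zero_object C (P n)"
    using ex_finite_syzygy_chain[OF assms, of m] by blast
  then show "proj_dim C X \<le> enat m"
    using syzygy_chain_resolution proj_dim_le_iff by metis
qed

lemma inj_dim_le_iff_ext_vanishes:
  assumes "Y \<in> Obj C"
  shows "inj_dim C Y \<le> enat m \<longleftrightarrow> (\<forall>n\<ge>m. \<forall>X \<in> Obj C. ext_vanishes C n X Y)"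
  using enough_category.proj_dim_le_iff_ext_vanishes[OF enough_category_opp, of Y m] assms
  by (simp add: inj_dim_eq ext_vanishes_opp)

lemma ext_vanishes_iso_left:
  assumes "isomorphic_objects C X X'" "ext_vanishes C n X Y" "Y \<in> Obj C"
  shows "ext_vanishes C n X' Y"
proof -
  have "X \<in> Obj C" "X' \<in> Obj C"
    using assms(1) Hom_objD by (auto simp: isomorphic_objects_def)
  then show ?thesis
    using enough_category.ext_vanishes_iso[OF enough_category_opp, of X X' n Y] assms
    by (simp add: ext_vanishes_opp)
qed

lemma proj_dim_iso_le:
  assumes "isomorphic_objects C X X'"
  shows "proj_dim C X' \<le> proj_dim C X"
proof (cases "proj_dim C X")
  case (enat m)
  have "X \<in> Obj C" "X' \<in> Obj C"
    using assms Hom_objD by (auto simp: isomorphic_objects_def)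
  then show ?thesis
    using proj_dim_le_iff_ext_vanishes[of X m] proj_dim_le_iff_ext_vanishes[of X' m]
      ext_vanishes_iso_left[OF assms] enat by auto
qed simp

lemma inj_dim_iso_le: "isomorphic_objects C X X' \<Longrightarrow> inj_dim C X' \<le> inj_dim C X"
  using enough_category.proj_dim_iso_le[OF enough_category_opp] by (simp add: inj_dim_eq)

text \<open>By balance, vanishing can be tested on an injective resolution of \<open>Y\<close>,
  where it is the lifting property of \<open>P\<close> along the epics \<open>p n\<close>.\<close>

lemma proj_dim_projective:
  assumes P: "projective_object C P"
  shows "proj_dim C P = 0"
proof -
  have Po: "P \<in> Obj C" using P by (simp add: projective_object_def)
  have "ext_vanishes C n P Y" if Y: "Y \<in> Obj C" for n Y
  proof -
    obtain Z I p j where Z: "syzygy_chain (opp C) Y Z I p j" using ex_cosyzygy_chain Y by blast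
    note s = short_exactD[OF cosyzygy_chainD(3)[OF Z]]
    show ?thesis
      unfolding ext_vanishes_iff_lifts[OF Z Po Y] extends_along_def
      using projectiveD[OF P s(4,2)] by simp
  qed
  then have "proj_dim C P \<le> enat 0" using proj_dim_le_iff_ext_vanishes[OF Po] by blast
  then show ?thesis by (simp add: zero_enat_def[symmetric])
qed

lemma inj_dim_injective: "injective_object C I \<Longrightarrow> inj_dim C I = 0"
  using enough_category.proj_dim_projective[OF enough_category_opp] by (simp add: inj_dim_eq)

text \<open>The exactness of \<open>Ext n B Y \<rightarrow> Ext n K Y \<rightarrow> Ext (n + 1) A Y\<close>, in terms of an injective
  resolution of \<open>Y\<close>.\<close>

lemma proj_dim_kernel_le:
  assumes s: "short_exact C K B A i q" and B: "proj_dim C B \<le> enat m" and A: "proj_dim C A \<le> enat m"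
  shows "proj_dim C K \<le> enat m"
proof -
  note a = short_exactD[OF s]
  have "ext_vanishes C n K Y" if n: "n \<ge> m" and Y: "Y \<in> Obj C" for n Y
  proof -
    obtain Z I p j where Z: "syzygy_chain (opp C) Y Z I p j" using ex_cosyzygy_chain Y by blast
    note z = cosyzygy_chainD[OF Z]
    \<comment> \<open>The obstruction to extending a morphism from \<open>K\<close> to
      \<open>Z (Suc n)\<close> along \<open>i\<close> lies one degree higher, in
      \<open>Ext (n + 2) A Y\<close>; hence the index \<open>Suc n\<close> for
      \<open>A\<close>.\<close>
    have "extends_along (opp C) (Z (Suc (Suc n))) (I (Suc n)) (p (Suc n)) A"
      using ext_vanishes_iff_lifts[OF Z a(8) Y, of "Suc n"] proj_dim_le_iff_ext_vanishes[OF a(8)] A n Y by simp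
    then have ext: "extends_along C K B i (Z (Suc n))"
      using extends_along_if_lifts[OF s z(3) z(2)] by blast
    have lifts: "extends_along (opp C) (Z (Suc n)) (I n) (p n) B"
      using ext_vanishes_iff_lifts[OF Z a(7) Y, of n] proj_dim_le_iff_ext_vanishes[OF a(7)] B n Y by simp
    show ?thesis
      unfolding ext_vanishes_iff_lifts[OF Z a(6) Y] extends_along_def
    proof
      fix f assume "f \<in> Hom (opp C) (Z (Suc n)) K"
      then obtain g where g: "g \<in> Hom C B (Z (Suc n))" "g \<cdot> i = f"
        using ext by (auto simp: extends_along_def)
      then obtain h where h: "h \<in> Hom C B (I n)" "p n \<cdot> h = g"
        using lifts by (auto simp: extends_along_def)
      have "p n \<cdot> (h \<cdot> i) = f"
        using comp_assoc[OF a(1) h(1) short_exactD(2)[OF z(3)]] g h by simp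
      then show "\<exists>g \<in> Hom (opp C) (I n) K. Comp (opp C) g (p n) = f"
        using comp_hom[OF a(1) h(1)] by auto
    qed
  qed
  then show ?thesis using proj_dim_le_iff_ext_vanishes[OF a(6)] by blast
qed

text \<open>A finite injective resolution ends in a zero cosyzygy. Going back along it,
  \<open>proj_dim_kernel_le\<close> preserves the bound \<open>spli C\<close>, so the length
  \<open>m\<close> does not enter the conclusion.\<close>

lemma proj_dim_le_spli:
  assumes X: "X \<in> Obj C" and id: "inj_dim C X \<le> enat m"
  shows "proj_dim C X \<le> spli C"
proof (cases "spli C")
  case (enat s)
  have "ext_vanishes (opp C) m X Y" if "Y \<in> Obj C" for Y
    using inj_dim_le_iff_ext_vanishes[OF X, of m] id that X by (simp add: ext_vanishes_opp)
  then obtain Z I p j where Z: "syzygy_chain (opp C) X Z I p j" "\<And>n. n > m \<Longrightarrow> zero_object C (Z n)"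
    using enough_category.ex_finite_syzygy_chain[OF enough_category_opp, of X m] X
    by (metis opp_simps(1) zero_object_opp)
  note z = cosyzygy_chainD[OF Z(1)]
  \<comment> \<open>Downward induction from the zero object \<open>Z (Suc m)\<close> to
    \<open>Z 0 = X\<close>.\<close>
  have "proj_dim C (Z n) \<le> enat s" if "n \<le> Suc m" for n
    using that
  proof (induction rule: inc_induct)
    case base
    then show ?case
      using proj_dim_projective[OF zero_object_projective[OF Z(2)]] by simp
  next
    case (step n)
    have "proj_dim C (I n) \<le> spli C"
      unfolding spli_def by (rule SUP_upper) (simp add: z(2))
    then show ?case using proj_dim_kernel_le[OF z(3)] step.IH enat by simp
  qed
  from this[of 0] show ?thesis using z(1) enat by simp
qed simp

end

section \<open>Ext groups\<close>

text \<open>Stated for a subset containing the unit, so that it applies to the coboundaries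
  directly. Cardinality one expresses triviality in a form preserved by isomorphisms.\<close>

lemma (in group) card_FactGroup_eq_1_iff:
  assumes "H \<subseteq> carrier G" "\<one> \<in> H"
  shows "card (carrier (G Mod H)) = 1 \<longleftrightarrow> H = carrier G"
proof
  assume "card (carrier (G Mod H)) = 1"
  then obtain S where S: "rcosets H = {S}" by (auto simp: FactGroup_def card_1_singleton_iff)
  have "a \<in> H" if a: "a \<in> carrier G" for a
  proof -
    have "H #> a = H #> \<one>" using S rcosetsI[OF assms(1)] a by auto
    moreover have "\<one> \<otimes> a \<in> H #> a" using assms(2) by (auto simp: r_coset_def)
    ultimately show ?thesis using assms a by simp
  qed
  then show "H = carrier G" using assms by blast
next
  assume H: "H = carrier G"
  have "carrier (G Mod H) = (\<lambda>a. H #> a) ` carrier G"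
    by (auto simp: FactGroup_def RCOSETS_def)
  also have "\<dots> = {H}"
    using H coset_join2[OF _ subgroup_self] by auto
  finally show "card (carrier (G Mod H)) = 1" by simp
qed

context preadditive_category
begin

text \<open>Composition with the epic \<open>q (Suc n)\<close> identifies the cocycles in degree
  \<open>n + 1\<close> with the morphisms from \<open>K (Suc n)\<close> to \<open>Y\<close>, and the
  coboundaries with those that extend along \<open>i n\<close>.\<close>

lemma card_hom_cohomology:
  assumes K: "syzygy_chain C X K P i q" and d: "\<And>n. d n = i n \<cdot> q (Suc n)" and Y: "Y \<in> Obj C"
  shows "card (carrier (hom_cohomology C P d Y (Suc n))) = 1 \<longleftrightarrow>
    extends_along C (K (Suc n)) (P n) (i n) Y"
proof -
  note s = short_exactD[OF syzygy_chainD(3)[OF K]]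
  have dh: "d n \<in> Hom C (P (Suc n)) (P n)" for n using d comp_hom[OF s(2) s(1)] by simp
  let ?G = "hom_group C (P (Suc n)) Y" and ?H = "hom_group C (P (Suc (Suc n))) Y"
  interpret G: comm_group ?G using hom_comm_group s(7) Y by blast
  interpret H: comm_group ?H using hom_comm_group s(7) Y by blast
  interpret h: group_hom ?G ?H "\<lambda>f. f \<cdot> d (Suc n)"
    by unfold_locales
      (auto simp: hom_def hom_group_def intro: comp_hom[OF dh] comp_add_left[OF dh])
  let ?Z = "hom_cocycles C P d Y (Suc n)" and ?B = "hom_coboundaries C P d Y (Suc n)"
  have Z: "?Z = {f \<in> Hom C (P (Suc n)) Y. f \<cdot> d (Suc n) = ZeroMor C (P (Suc (Suc n))) Y}"
    by (simp add: hom_cocycles_def kernel_def hom_group_def)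
  have cocycle: "f \<in> ?Z \<longleftrightarrow> (\<exists>g \<in> Hom C (K (Suc n)) Y. f = g \<cdot> q (Suc n))" for f
  proof
    assume f: "f \<in> ?Z"
    then have fh: "f \<in> Hom C (P (Suc n)) Y" by (simp add: Z)
    have "f \<cdot> i (Suc n) \<cdot> q (Suc (Suc n)) = ZeroMor C (K (Suc (Suc n))) Y \<cdot> q (Suc (Suc n))"
      using f comp_assoc[OF s(2) s(1) fh] comp_zero_left[OF s(2) Y] by (simp add: Z d)
    then have "f \<cdot> i (Suc n) = ZeroMor C (K (Suc (Suc n))) Y"
      using epicD[OF s(4) s(2) comp_hom[OF s(1) fh] zero_hom[OF s(6) Y]] by blast
    then show "\<exists>g \<in> Hom C (K (Suc n)) Y. f = g \<cdot> q (Suc n)" using s(10) fh by blast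
  next
    assume "\<exists>g \<in> Hom C (K (Suc n)) Y. f = g \<cdot> q (Suc n)"
    then obtain g where g: "g \<in> Hom C (K (Suc n)) Y" "f = g \<cdot> q (Suc n)" by blast
    have "f \<cdot> d (Suc n) = g \<cdot> (q (Suc n) \<cdot> i (Suc n) \<cdot> q (Suc (Suc n)))"
      using g d comp_assoc[OF dh s(2) g(1)] comp_assoc[OF s(2) s(1) s(2)] by simp
    also have "\<dots> = ZeroMor C (P (Suc (Suc n))) Y"
      using s(5) comp_zero_left[OF s(2) s(6)] comp_zero_right[OF g(1) s(7)] by simp
    finally show "f \<in> ?Z" using g comp_hom[OF s(2) g(1)] by (simp add: Z)
  qed
  have coboundary: "h \<cdot> d n = h \<cdot> i n \<cdot> q (Suc n)" if "h \<in> Hom C (P n) Y" for h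
    using comp_assoc[OF s(2) s(1) that] by (simp add: d)
  have B: "?B = (\<lambda>h. h \<cdot> i n \<cdot> q (Suc n)) ` Hom C (P n) Y"
    by (simp add: hom_coboundaries_def coboundary cong: image_cong)
  have BZ: "?B \<subseteq> ?Z" using cocycle comp_hom[OF s(1)] unfolding B by blast
  have "ZeroMor C (P n) Y \<cdot> i n \<cdot> q (Suc n) = ZeroMor C (P (Suc n)) Y"
    using comp_zero_left[OF s(1) Y] comp_zero_left[OF s(2) Y] by simp
  then have o: "ZeroMor C (P (Suc n)) Y \<in> ?B" using zero_hom[OF s(7) Y] B by (metis imageI)
  have "subgroup ?Z ?G" unfolding hom_cocycles_def by (rule h.subgroup_kernel)
  then interpret Z: group "?G\<lparr>carrier := ?Z\<rparr>" by (rule G.subgroup_imp_group)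
  have "card (carrier (hom_cohomology C P d Y (Suc n))) = 1 \<longleftrightarrow> ?B = ?Z"
    using Z.card_FactGroup_eq_1_iff[of ?B] BZ o by (simp add: hom_cohomology_def hom_group_def)
  also have "\<dots> \<longleftrightarrow> (\<forall>g \<in> Hom C (K (Suc n)) Y. g \<cdot> q (Suc n) \<in> ?B)"
  proof -
    have "?Z = (\<lambda>g. g \<cdot> q (Suc n)) ` Hom C (K (Suc n)) Y"
      using cocycle by blast
    then have "?Z \<subseteq> ?B \<longleftrightarrow> (\<forall>g \<in> Hom C (K (Suc n)) Y. g \<cdot> q (Suc n) \<in> ?B)"
      by (simp only: image_subset_iff)
    then show ?thesis using BZ by (simp only: set_eq_subset simp_thms)
  qed
  also have "\<dots> \<longleftrightarrow> extends_along C (K (Suc n)) (P n) (i n) Y"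
    unfolding extends_along_def
  proof (rule ball_cong[OF refl])
    fix g assume g: "g \<in> Hom C (K (Suc n)) Y"
    show "g \<cdot> q (Suc n) \<in> ?B \<longleftrightarrow> (\<exists>h \<in> Hom C (P n) Y. h \<cdot> i n = g)"
      using epicD[OF s(4) s(2) g comp_hom[OF s(1)]] by (auto simp: B)
  qed
  finally show ?thesis .
qed

end

text \<open>The resolution picked by \<open>SOME\<close> is cut into a syzygy chain; by
  \<open>ext_vanishes_iff\<close> the outcome does not depend on the choice.\<close>

lemma (in enough_category) trivial_Ext_iff:
  assumes X: "X \<in> Obj C" and Y: "Y \<in> Obj C"
  shows "card (carrier (Ext C (Suc n) X Y)) = 1 \<longleftrightarrow> ext_vanishes C n X Y"
proof -
  obtain P d e where r: "(SOME (P, d, e). projective_resolution C X P d e) = (P, d, e)"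
    by (metis prod_cases3)
  have "\<exists>r. case r of (P, d, e) \<Rightarrow> projective_resolution C X P d e"
    using ex_syzygy_chain[OF X] syzygy_chain_resolution by fast
  from someI_ex[OF this] have P: "projective_resolution C X P d e" unfolding r by simp
  obtain K i q where "syzygy_chain C X K P i q" "d = (\<lambda>n. i n \<cdot> q (Suc n))"
    by (rule projective_resolution_chain[OF P])
  then show ?thesis
    using card_hom_cohomology[OF _ _ Y] ext_vanishes_iff[OF _ Y] by (simp add: Ext_def r)
qed

section \<open>Homological isomorphisms\<close>

text \<open>Reduces a comparison of dimensions to finite bounds \<open>m \<ge> t\<close>, for which
  all degrees above \<open>m\<close> are also above \<open>t\<close>.\<close>

lemma enat_le_sup_if:
  assumes "\<And>m. a \<le> enat m \<Longrightarrow> t \<le> m \<Longrightarrow> b \<le> enat m"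
  shows "b \<le> sup a (enat t)"
proof (cases a)
  case (enat m)
  then show ?thesis using assms[of "max m t"] by (cases "m \<le> t") (auto simp: sup_enat_def max_def)
qed (simp add: sup_enat_def)

lemma homological_isomorphism_mono:
  "homological_isomorphism D F fo s \<Longrightarrow> s \<le> t \<Longrightarrow> homological_isomorphism D F fo t"
  by (auto simp: homological_isomorphism_def)

lemma iso_card_carrier: "G \<cong> H \<Longrightarrow> card (carrier G) = card (carrier H)"
  by (auto simp: is_iso_def iso_def intro: bij_betw_same_card)

text \<open>Recording the functor by its map on objects makes the setting self-dual, see
  \<open>opp_pair\<close>.\<close>

locale enough_category_pair = D: enough_category D + F: enough_category F
  for D :: "('o, 'm) precat" and F :: "('p, 'n) precat" +
  fixes fo :: "'o \<Rightarrow> 'p"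
  assumes fo_obj: "X \<in> Obj D \<Longrightarrow> fo X \<in> Obj F"
begin

lemma opp_pair: "enough_category_pair (opp D) (opp F) fo"
  using D.enough_category_opp F.enough_category_opp fo_obj
  by (simp add: enough_category_pair_def enough_category_pair_axioms_def)

lemma condition_a_opp: "condition_a (opp D) (opp F) fo t \<longleftrightarrow> condition_a D F fo t"
  by (auto simp: condition_a_def D.inj_dim_opp F.inj_dim_opp D.inj_dim_eq F.inj_dim_eq)

lemma condition_b_opp: "condition_b (opp D) (opp F) fo t \<longleftrightarrow> condition_b D F fo t"
  by (auto simp: condition_b_def D.inj_dim_opp F.inj_dim_opp D.inj_dim_eq F.inj_dim_eq)

lemma essentially_surjective_opp:
  "essentially_surjective (opp D) (opp F) fo \<longleftrightarrow> essentially_surjective D F fo"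
  by (simp add: essentially_surjective_def)

lemma ext_vanishes_fo_iff:
  assumes "homological_isomorphism D F fo (int t)" "n \<ge> t" "X \<in> Obj D" "Y \<in> Obj D"
  shows "ext_vanishes F n (fo X) (fo Y) \<longleftrightarrow> ext_vanishes D n X Y"
proof -
  have "int (Suc n) > int t" using assms(2) by simp
  then have "Ext D (Suc n) X Y \<cong> Ext F (Suc n) (fo X) (fo Y)"
    using assms(1,3,4) unfolding homological_isomorphism_def by blast
  from iso_card_carrier[OF this] show ?thesis
    using D.trivial_Ext_iff F.trivial_Ext_iff assms(3,4) fo_obj by metis
qed

lemma condition_a_if_homological_isomorphism:
  assumes h: "homological_isomorphism D F fo (int t)"
  shows "condition_a D F fo t"
  unfolding condition_a_def
proof (intro ballI conjI)
  fix X assume X: "X \<in> Obj D"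
  show "proj_dim D X \<le> sup (proj_dim F (fo X)) (enat t)"
  proof (rule enat_le_sup_if)
    fix m assume m: "proj_dim F (fo X) \<le> enat m" "t \<le> m"
    have "ext_vanishes D n X Y" if "n \<ge> m" "Y \<in> Obj D" for n Y
      using F.proj_dim_le_iff_ext_vanishes[OF fo_obj[OF X], of m] m that fo_obj[OF that(2)]
        ext_vanishes_fo_iff[OF h, of n X Y] X by simp
    then show "proj_dim D X \<le> enat m" using D.proj_dim_le_iff_ext_vanishes[OF X] by blast
  qed
  \<comment> \<open>The hypothesis speaks of Ext in \<open>D\<close> and \<open>F\<close>, not in
    their opposites, so this half uses vanishing in the second argument instead of duality.\<close>
  show "inj_dim D X \<le> sup (inj_dim F (fo X)) (enat t)"
  proof (rule enat_le_sup_if)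
    fix m assume m: "inj_dim F (fo X) \<le> enat m" "t \<le> m"
    have "ext_vanishes D n Y X" if "n \<ge> m" "Y \<in> Obj D" for n Y
      using F.inj_dim_le_iff_ext_vanishes[OF fo_obj[OF X], of m] m that fo_obj[OF that(2)]
        ext_vanishes_fo_iff[OF h, of n Y X] X by simp
    then show "inj_dim D X \<le> enat m" using D.inj_dim_le_iff_ext_vanishes[OF X] by blast
  qed
qed

text \<open>Every test object of \<open>F\<close> is isomorphic to some \<open>fo Y'\<close>, and
  vanishing of Ext is invariant under isomorphism in either argument.\<close>

lemma condition_b_if_homological_isomorphism:
  assumes h: "homological_isomorphism D F fo (int t)" and es: "essentially_surjective D F fo"
  shows "condition_b D F fo t"
  unfolding condition_b_def
proof (intro ballI conjI)
  fix X assume X: "X \<in> Obj D"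
  have ex: "\<exists>Y' \<in> Obj D. isomorphic_objects F (fo Y') Y" if "Y \<in> Obj F" for Y
    using es that by (auto simp: essentially_surjective_def)
  show "proj_dim F (fo X) \<le> sup (proj_dim D X) (enat t)"
  proof (rule enat_le_sup_if)
    fix m assume m: "proj_dim D X \<le> enat m" "t \<le> m"
    have "ext_vanishes F n (fo X) Y" if "n \<ge> m" "Y \<in> Obj F" for n Y
      using ex[OF that(2)] F.ext_vanishes_iso ext_vanishes_fo_iff[OF h _ X] m that
        D.proj_dim_le_iff_ext_vanishes[OF X] by (meson order_trans)
    then show "proj_dim F (fo X) \<le> enat m"
      using F.proj_dim_le_iff_ext_vanishes[OF fo_obj[OF X]] by blast
  qed
  show "inj_dim F (fo X) \<le> sup (inj_dim D X) (enat t)"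
  proof (rule enat_le_sup_if)
    fix m assume m: "inj_dim D X \<le> enat m" "t \<le> m"
    have "ext_vanishes F n Y (fo X)" if "n \<ge> m" "Y \<in> Obj F" for n Y
      using ex[OF that(2)] F.ext_vanishes_iso_left[OF _ _ fo_obj[OF X]]
        ext_vanishes_fo_iff[OF h _ _ X] m that
        D.inj_dim_le_iff_ext_vanishes[OF X] by (meson order_trans)
    then show "inj_dim F (fo X) \<le> enat m"
      using F.inj_dim_le_iff_ext_vanishes[OF fo_obj[OF X]] by blast
  qed
qed

text \<open>For injective \<open>I\<close>, (b) makes the injective dimension of \<open>fo I\<close>
  finite, so its projective dimension is at most \<open>spli F\<close>; (a) carries this bound back
  to \<open>I\<close>.\<close>

lemma spli_source_le:
  assumes a: "condition_a D F fo t" and b: "condition_b D F fo t"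
  shows "spli D \<le> sup (spli F) (enat t)"
  unfolding spli_def[of D]
proof (rule SUP_least)
  fix I assume "I \<in> {I. injective_object D I}"
  then have I: "injective_object D I" "I \<in> Obj D" by (auto simp: injective_object_def)
  have "inj_dim F (fo I) \<le> enat t"
  proof -
    have "inj_dim F (fo I) \<le> sup 0 (enat t)"
      using b I D.inj_dim_injective[OF I(1)] unfolding condition_b_def by metis
    then show ?thesis by (simp add: sup_enat_def)
  qed
  then have "proj_dim F (fo I) \<le> spli F" using F.proj_dim_le_spli fo_obj I by blast
  moreover have "proj_dim D I \<le> sup (proj_dim F (fo I)) (enat t)"
    using a I by (simp add: condition_a_def)
  ultimately show "proj_dim D I \<le> sup (spli F) (enat t)"
    by (meson order_trans sup_mono order_refl)
qed

text \<open>A preimage \<open>X\<close> of an injective \<open>J\<close> up to isomorphism has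
  injective dimension at most \<open>t\<close> by (a), which is enough for
  \<open>proj_dim_le_spli\<close>; (b) then carries the bound to \<open>J\<close>.\<close>

lemma spli_target_le:
  assumes a: "condition_a D F fo t" and b: "condition_b D F fo t"
    and es: "essentially_surjective D F fo"
  shows "spli F \<le> sup (spli D) (enat t)"
  unfolding spli_def[of F]
proof (rule SUP_least)
  fix J assume "J \<in> {I. injective_object F I}"
  then have J: "injective_object F J" "J \<in> Obj F" by (auto simp: injective_object_def)
  obtain X where X: "X \<in> Obj D" and iso: "isomorphic_objects F (fo X) J"
    using es J by (auto simp: essentially_surjective_def)
  then have "isomorphic_objects F J (fo X)" by (auto simp: isomorphic_objects_def)
  then have "inj_dim F (fo X) = 0"
    using F.inj_dim_iso_le F.inj_dim_injective[OF J(1)] by (metis le_zero_eq)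
  then have "inj_dim D X \<le> sup 0 (enat t)" using a X unfolding condition_a_def by metis
  then have "inj_dim D X \<le> enat t" by (simp add: sup_enat_def)
  then have "proj_dim D X \<le> spli D" using D.proj_dim_le_spli X by blast
  moreover have "proj_dim F (fo X) \<le> sup (proj_dim D X) (enat t)"
    using b X by (simp add: condition_b_def)
  ultimately show "proj_dim F J \<le> sup (spli D) (enat t)"
    using F.proj_dim_iso_le[OF iso] by (meson order_trans sup_mono order_refl)
qed

text \<open>The half on \<open>silp\<close> is the half on \<open>spli\<close> for the opposite
  categories, since (a) and (b) are self-dual.\<close>

lemma condition_c_if:
  assumes "condition_a D F fo t" "condition_b D F fo t"
  shows "condition_c D F t"
  using spli_source_le enough_category_pair.spli_source_le[OF opp_pair, of t] assms
  by (simp add: condition_c_def condition_a_opp condition_b_opp D.silp_eq F.silp_eq)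

lemma condition_d_if:
  assumes "condition_a D F fo t" "condition_b D F fo t" "essentially_surjective D F fo"
  shows "condition_d D F t"
  using spli_target_le enough_category_pair.spli_target_le[OF opp_pair, of t] assms
  by (simp add: condition_d_def condition_a_opp condition_b_opp essentially_surjective_opp
      D.silp_eq F.silp_eq)

end

section \<open>Transfer of the Gorenstein property\<close>

lemma enat_finite_if_le_sup:
  fixes a b :: enat
  assumes "a \<le> sup b (enat t)" "b < \<infinity>"
  shows "a < \<infinity>"
  using assms(1)
proof (rule le_less_trans)
  show "sup b (enat t) < \<infinity>"
    using assms(2) by (cases b) (auto simp: sup_enat_def max_def)
qed

lemma gorenstein_source: "condition_c D F t \<Longrightarrow> gorenstein F \<Longrightarrow> gorenstein D"
  unfolding condition_c_def gorenstein_def using enat_finite_if_le_sup by blast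

lemma gorenstein_target: "condition_d D F t \<Longrightarrow> gorenstein D \<Longrightarrow> gorenstein F"
  unfolding condition_d_def gorenstein_def using enat_finite_if_le_sup by blast

lemma condition_b_mono: "condition_b D F fo s \<Longrightarrow> s \<le> t \<Longrightarrow> condition_b D F fo t"
  unfolding condition_b_def by (meson enat_ord_simps(1) order_trans sup_mono order_refl)

theorem theorem4p3:
  fixes D :: "('o, 'm) precat" and F :: "('p, 'n) precat"
    and fo :: "'o \<Rightarrow> 'p" and fm :: "'m \<Rightarrow> 'n" and t :: nat
  assumes "abelian_category D" and "enough_projectives D" and "enough_injectives D"
    and "abelian_category F" and "enough_projectives F" and "enough_injectives F"
    and "cat_functor D F fo fm"
  shows "(homological_isomorphism D F fo (int t) \<longrightarrow> condition_a D F fo t)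
    \<and> (essentially_surjective D F fo \<and> homological_isomorphism D F fo (int t) \<longrightarrow>
        condition_a D F fo t \<and> condition_b D F fo t)
    \<and> (condition_a D F fo t \<and> condition_b D F fo t \<longrightarrow> condition_c D F t)
    \<and> (condition_a D F fo t \<and> condition_b D F fo t \<and> essentially_surjective D F fo \<longrightarrow>
        condition_c D F t \<and> condition_d D F t)
    \<and> (essentially_surjective D F fo \<and> eventually_homological_isomorphism D F fo \<longrightarrow>
        (gorenstein D \<longleftrightarrow> gorenstein F))
    \<and> (eventually_homological_isomorphism D F fo \<and> condition_b D F fo t \<longrightarrow>
        (gorenstein F \<longrightarrow> gorenstein D))"
proof -
  interpret cat_functor D F fo fm by fact
  interpret D: enough_category D
    using assms by (simp add: enough_category_def enough_category_axioms_def)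
  interpret F: enough_category F
    using assms by (simp add: enough_category_def enough_category_axioms_def)
  interpret enough_category_pair D F fo by unfold_locales (fact map_obj)
  \<comment> \<open>The given bound \<open>k\<close> may be negative or below \<open>t\<close>.
    Raising it to a natural number \<open>s \<ge> t\<close> lets it be combined with (b), which is
    monotone in the bound.\<close>
  have bound: "\<exists>s\<ge>t. homological_isomorphism D F fo (int s)"
    if ev: "eventually_homological_isomorphism D F fo"
  proof -
    obtain k where "homological_isomorphism D F fo k"
      using ev by (auto simp: eventually_homological_isomorphism_def)
    then have "homological_isomorphism D F fo (int (max t (nat k)))"
      by (rule homological_isomorphism_mono) auto
    then show ?thesis by (meson max.cobounded1)
  qed
  have "gorenstein D \<longleftrightarrow> gorenstein F"
    if es: "essentially_surjective D F fo" and ev: "eventually_homological_isomorphism D F fo"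
  proof -
    obtain s where s: "homological_isomorphism D F fo (int s)" using bound[OF ev] by blast
    have ab: "condition_a D F fo s" "condition_b D F fo s"
      using condition_a_if_homological_isomorphism[OF s]
        condition_b_if_homological_isomorphism[OF s es] by blast+
    show ?thesis
      using gorenstein_source[OF condition_c_if[OF ab]]
        gorenstein_target[OF condition_d_if[OF ab es]] by blast
  qed
  moreover have "gorenstein D"
    if ev: "eventually_homological_isomorphism D F fo" and b: "condition_b D F fo t"
      and G: "gorenstein F"
  proof -
    obtain s where s: "s \<ge> t" "homological_isomorphism D F fo (int s)" using bound[OF ev] by blast
    show ?thesis
      using gorenstein_source[OF condition_c_if G] condition_b_mono[OF b s(1)]
        condition_a_if_homological_isomorphism[OF s(2)] by blast
  qed
  ultimately show ?thesis
    using condition_a_if_homological_isomorphism condition_b_if_homological_isomorphism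
      condition_c_if condition_d_if by blast
qed

end
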